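(* Let $\mathcal{F}=H^1(\omega)^3\times L^2(\omega)^3\times L^2(\omega)\times\mathbb{R}^2$ and $\mathcal{E}=H^1(\omega)^3\times L^2(\omega)^3\times L^2(\omega)\times\mathbb{R}^2$, where $\omega=(0,L)$. Write elements of $\mathcal F$ as $[f_\omega,\mathbf{f}_B]$ with $f_\omega=[f_S,f_R,f_P]$, $\mathbf f_B=[f_B|_L,\ f_B|_0]^T$, and elements of $\mathcal E$ as $[e_\omega,\mathbf{e}_B]$ with $e_\omega=[e_S,e_R,e_P]$, $e_S=[e_{S_1},e_{S_2},e_{S_3}]^T$, $\mathbf e_B=[e_B|_L,\ e_B|_0]^T$. Let $\mathcal{D}\subset\mathcal{F}\times\mathcal{E}$ be the linear subset of all $[[f_\omega,\mathbf{f}_B],[e_\omega,\mathbf{e}_B]]\in\mathcal F\times\mathcal E$ such that $[p\,e_{S_3},\ \tfrac{e}{\rho}e_{S_2},\ \tfrac1\rho e_{S_2}]\in H^1(\omega)^3$, $$\begin{bmatrix}f_S\\ f_R\\ f_P\end{bmatrix}+\begin{bmatrix}J(z)&I&B\\-I&0&0\\-B^T&0&0\end{bmatrix}\begin{bmatrix}e_S\\ e_R\\ e_P\end{bmatrix}=\begin{bmatrix}0\\0\\0\end{bmatrix},$$ $$\begin{bmatrix}f_B|_L\\ e_B|_L\end{bmatrix}=\begin{bmatrix}0&-1&0\\1&0&\frac{e+p}{\rho}|_L\end{bmatrix}e_S|_L,\qquad \begin{bmatrix}f_B|_0\\ e_B|_0\end{bmatrix}=\begin{bmatrix}0&1&0\\1&0&\frac{e+p}{\rho}|_0\end{bmatrix}e_S|_0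 .$$ Then $\mathcal{D}$ is a Stokes-Dirac structure, i.e. $\mathcal D=\mathcal D^\perp$. Furthermore, the system of equations $$f_S=-E(z)\partial_t z,\quad e_S=\frac{\delta\mathcal H}{\delta z}(z),\quad e_R=-R(z)f_R,\quad e_P=T_\infty,\quad [[f_\omega,\mathbf f_B],[e_\omega,\mathbf e_B]]\in\mathcal D,$$ is equivalent to the port-Hamiltonian system $$E(z)\partial_t z=(J(z)-R(z))\tilde e(z)+B\,T_\infty,\qquad y=B^T\tilde e(z)$$ (with output $y=f_P$), and the identity $\langle[f_\omega,\mathbf f_B],[e_\omega,\mathbf e_B]\rangle=0$, which represents the power-balance equation, holds for all $[[f_\omega,\mathbf f_B],[e_\omega,\mathbf e_B]]\in\mathcal D$.
   Context: Setting: pipe $\omega=(0,L)$, $L>0$. State $z=[\rho,v,e]^T$ (mass density, velocity, internal energy density), depending on time and space. Ideal gas: $p=RT\rho$, $e=\rho\epsilon=\rho c_vT$ with positive constants $R,c_v$, hence $p=\frac{R}{c_v}e$, $T=\frac{e}{c_v\rho}$. Constants: diameter $d>0$, friction factor $\lambda\ge 0$, thermal conductivity $k_\omega\ge0$, ambient temperature $T_\infty\ge 0$. At each time $z$ is assumed smooth enough that all expressions make sense (e.g. $\rho,v,e\in H^1(\omega)$ with $\rho$ bounded below by a positive constant), $T\ge0$; for the equivalence, $z$ is assumed to be regular enough in time and space that the variables lie in the stated spaces. System operators: $$E(z)=I_3,\quad R(z)=\mathrm{diag}\left(0,0,\tfrac{k_\omega}{d}T\right),\quad B=\left[0,0,\tfrac{k_\omega}{d}\right]^T,$$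 $$J(z)=\begin{bmatrix}0&-D_x&0\\-D_x&0&-\frac{\lambda}{2d}v|v|-\frac{e}{\rho}D_x-\frac1\rho D_xp\\0&\frac{\lambda}{2d}v|v|-D_x\frac e\rho-pD_x\frac1\rho&0\end{bmatrix},$$ where $(g_1D_xg_2)g_3:=g_1\partial_x(g_2g_3)$. The effort function is $\tilde e(z)=[\frac{v^2}{2},\rho v,1]^T$, the Hamiltonian is $\mathcal H(z)=\int_\omega \rho\frac{v^2}{2}+e\,dx$, and $\frac{\delta\mathcal H}{\delta z}(z)=\tilde e(z)$ is its variational derivative. Power product: $\langle[f_\omega,\mathbf f_B],[e_\omega,\mathbf e_B]\rangle=\int_\omega f_S\cdot e_S+f_R\cdot e_R+f_P\, e_P\,dx+\mathbf f_B\cdot\mathbf e_B$, with $\cdot$ the Euclidean inner product. Bilinear form on $\mathcal F\times\mathcal E$: $$\langle\langle[f,e],[\tilde f,\tilde e]\rangle\rangle=\langle f,\tilde e\rangle+\langle \tilde f,e\rangle ,$$ where $f=[f_\omega,\mathbf f_B]$, $e=[e_\omega,\mathbf e_B]$ and similarly for the tilde quantities. The orthogonal complement is $\mathcal D^\perp=\{[\tilde f,\tilde e]\in\mathcal F\times\mathcal E:\ \langle\langle[\tilde f,\tilde e],[f,e]\rangle\rangle=0\ \ \forall[f,e]\in\mathcal D\}$. A subset $\mathcal D\subset\mathcal F\times\mathcal E$ is a Stokes-Dirac structure if $\mathcal D=\mathcal D^\perp$. (The dual of the flow space is identified with the flow space through the inner product, so $\mathcal E=\mathcal F$.) *)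

theory Defs
  imports "HOL-Analysis.Analysis"
begin

section \<open>Function spaces on the interval \<open>(0,L)\<close>\<close>

text \<open>Elements of \<open>L\<^sup>2(0,L)\<close> and \<open>H\<^sup>1(0,L)\<close> are represented by functions on \<open>real\<close>; only the
  values almost everywhere on \<open>(0,L)\<close> matter.  All sets of functions below are closed under
  almost-everywhere equality (the measure is complete), so that equalities between such sets are
  the same as equalities between the corresponding sets of equivalence classes.\<close>

abbreviation omega_measure :: "real \<Rightarrow> real measure" where
  "omega_measure L \<equiv> lebesgue_on {0<..<L}"

definition Lsq :: "real \<Rightarrow> (real \<Rightarrow> real) set" where
  "Lsq L = {u. u \<in> borel_measurable (omega_measure L) \<and>
               integrable (omega_measure L) (\<lambda>x. (u x)\<^sup>2)}"

text \<open>Weak derivatives are taken against \<open>C\<^sup>1\<close> functions with compact support in \<open>(0,L)\<close>, as in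
  Brezis, \<^emph>\<open>Functional Analysis, Sobolev Spaces and Partial Differential Equations\<close>, Section 8.2.
  By mollification this is the same as using smooth test functions.\<close>

definition test_functions :: "real \<Rightarrow> (real \<Rightarrow> real) set" where
  "test_functions L = {\<phi>. \<phi> C1_differentiable_on UNIV \<and>
     (\<exists>K. compact K \<and> K \<subseteq> {0<..<L} \<and> (\<forall>x. x \<notin> K \<longrightarrow> \<phi> x = 0))}"

definition has_weak_deriv :: "real \<Rightarrow> (real \<Rightarrow> real) \<Rightarrow> (real \<Rightarrow> real) \<Rightarrow> bool" where
  "has_weak_deriv L u g \<longleftrightarrow> u \<in> Lsq L \<and> g \<in> Lsq L \<and>
     (\<forall>\<phi>\<in>test_functions L.
        (LINT x|omega_measure L. u x * deriv \<phi> x) = - (LINT x|omega_measure L. g x * \<phi> x))"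

definition H1 :: "real \<Rightarrow> (real \<Rightarrow> real) set" where
  "H1 L = {u. \<exists>g. has_weak_deriv L u g}"

text \<open>Meaningful for \<open>u \<in> H1 L\<close> only, and then unique up to null sets.\<close>

definition Dx :: "real \<Rightarrow> (real \<Rightarrow> real) \<Rightarrow> real \<Rightarrow> real" where
  "Dx L u = (SOME g. has_weak_deriv L u g)"

text \<open>The boundary value at \<open>a \<in> {0, L}\<close> of a function \<open>u \<in> H1 L\<close> is the value of its continuous
  representative on \<open>[0,L]\<close>; the pointwise value \<open>u a\<close> of an arbitrary representative would be
  meaningless.\<close>

definition cont_rep :: "real \<Rightarrow> (real \<Rightarrow> real) \<Rightarrow> real \<Rightarrow> real" where
  "cont_rep L u = (SOME w. continuous_on {0..L} w \<and> (AE x in omega_measure L. u x = w x))"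

definition bdry_value :: "real \<Rightarrow> (real \<Rightarrow> real) \<Rightarrow> real \<Rightarrow> real" where
  "bdry_value L u a = cont_rep L u a"

definition cubed :: "(real \<Rightarrow> real) set \<Rightarrow> (real \<Rightarrow> real^3) set" where
  "cubed X = {u. \<forall>i. (\<lambda>x. u x $ i) \<in> X}"


section \<open>Ports, power product and Stokes-Dirac structures\<close>

text \<open>Flows and efforts live in the same space, so one record type serves for both.  The
  boundary part is \<open>port_B = [value at L, value at 0]\<close>.\<close>

record port =
  port_S :: "real \<Rightarrow> real^3"
  port_R :: "real \<Rightarrow> real^3"
  port_P :: "real \<Rightarrow> real"
  port_B :: "real^2"

definition port_space :: "real \<Rightarrow> port set" where
  "port_space L = {f. port_S f \<in> cubed (H1 L) \<and> port_R f \<in> cubed (Lsq L) \<and> port_P f \<in> Lsq L}"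

definition power_product :: "real \<Rightarrow> port \<Rightarrow> port \<Rightarrow> real" where
  "power_product L f e =
     (LINT x|omega_measure L.
        port_S f x \<bullet> port_S e x + port_R f x \<bullet> port_R e x + port_P f x * port_P e x)
     + port_B f \<bullet> port_B e"

definition bilinear_form :: "real \<Rightarrow> port \<times> port \<Rightarrow> port \<times> port \<Rightarrow> real" where
  "bilinear_form L a b = power_product L (fst a) (snd b) + power_product L (fst b) (snd a)"

definition orth_compl :: "real \<Rightarrow> (port \<times> port) set \<Rightarrow> (port \<times> port) set" where
  "orth_compl L D = {b \<in> port_space L \<times> port_space L. \<forall>a\<in>D. bilinear_form L b a = 0}"

definition stokes_dirac :: "real \<Rightarrow> (port \<times> port) set \<Rightarrow> bool" where
  "stokes_dirac L D \<longleftrightarrow> D \<subseteq> port_space L \<times> port_space L \<and> D = orth_compl L D"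

definition port_comb :: "real \<Rightarrow> port \<Rightarrow> real \<Rightarrow> port \<Rightarrow> port" where
  "port_comb a f b g =
     \<lparr> port_S = (\<lambda>x. a *\<^sub>R port_S f x + b *\<^sub>R port_S g x),
       port_R = (\<lambda>x. a *\<^sub>R port_R f x + b *\<^sub>R port_R g x),
       port_P = (\<lambda>x. a * port_P f x + b * port_P g x),
       port_B = a *\<^sub>R port_B f + b *\<^sub>R port_B g \<rparr>"

definition linear_subset :: "(port \<times> port) set \<Rightarrow> bool" where
  "linear_subset D \<longleftrightarrow> D \<noteq> {} \<and>
     (\<forall>a b. \<forall>(f, e)\<in>D. \<forall>(f', e')\<in>D. (port_comb a f b f', port_comb a e b e') \<in> D)"


section \<open>Gas flow in a pipe\<close>

record pipe =
  len :: real        \<comment> \<open>\<open>L\<close>\<close>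
  diam :: real       \<comment> \<open>\<open>d\<close>\<close>
  gas_const :: real  \<comment> \<open>\<open>R\<close>\<close>
  heat_cap :: real   \<comment> \<open>\<open>c\<^sub>v\<close>\<close>
  fric :: real       \<comment> \<open>\<open>\<lambda>\<close>\<close>
  cond :: real       \<comment> \<open>\<open>k\<^sub>\<omega>\<close>\<close>
  T_amb :: real      \<comment> \<open>\<open>T\<^sub>\<infinity>\<close>\<close>

definition valid_pipe :: "pipe \<Rightarrow> bool" where
  "valid_pipe P \<longleftrightarrow> 0 < len P \<and> 0 < diam P \<and> 0 < gas_const P \<and> 0 < heat_cap P \<and>
     0 \<le> fric P \<and> 0 \<le> cond P \<and> 0 \<le> T_amb P"

text \<open>A state at a fixed time is \<open>z :: real \<Rightarrow> real^3\<close>, with components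
  \<open>[\<rho>, v, e]\<close>.\<close>

type_synonym state = "real \<Rightarrow> real^3"

definition density :: "state \<Rightarrow> real \<Rightarrow> real" where "density z x = z x $ 1"
definition velocity :: "state \<Rightarrow> real \<Rightarrow> real" where "velocity z x = z x $ 2"
definition energy :: "state \<Rightarrow> real \<Rightarrow> real" where "energy z x = z x $ 3"

definition pressure :: "pipe \<Rightarrow> state \<Rightarrow> real \<Rightarrow> real" where
  "pressure P z x = gas_const P / heat_cap P * energy z x"

definition temperature :: "pipe \<Rightarrow> state \<Rightarrow> real \<Rightarrow> real" where
  "temperature P z x = energy z x / (heat_cap P * density z x)"

definition admissible_state :: "pipe \<Rightarrow> state \<Rightarrow> bool" where
  "admissible_state P z \<longleftrightarrow> z \<in> cubed (H1 (len P)) \<and>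
     (\<exists>c>0. AE x in omega_measure (len P). c \<le> density z x) \<and>
     (AE x in omega_measure (len P). 0 \<le> temperature P z x)"

definition E_mat :: "state \<Rightarrow> real \<Rightarrow> real^3^3" where
  "E_mat z x = mat 1"

definition R_mat :: "pipe \<Rightarrow> state \<Rightarrow> real \<Rightarrow> real^3^3" where
  "R_mat P z x = vector [vector [0, 0, 0],
                         vector [0, 0, 0],
                         vector [0, 0, cond P / diam P * temperature P z x]]"

definition B_vec :: "pipe \<Rightarrow> real^3" where
  "B_vec P = vector [0, 0, cond P / diam P]"

text \<open>\<open>gDg L g1 g2\<close> is the operator \<open>g1 D\<^sub>x g2\<close>.\<close>

definition gDg ::
  "real \<Rightarrow> (real \<Rightarrow> real) \<Rightarrow> (real \<Rightarrow> real) \<Rightarrow> (real \<Rightarrow> real) \<Rightarrow> real \<Rightarrow> real" where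
  "gDg L g1 g2 g3 x = g1 x * Dx L (\<lambda>y. g2 y * g3 y) x"

text \<open>The components are the rows of the operator matrix \<open>J(z)\<close> applied to \<open>[u1, u2, u3]\<close>.\<close>

definition J_op :: "pipe \<Rightarrow> state \<Rightarrow> (real \<Rightarrow> real^3) \<Rightarrow> real \<Rightarrow> real^3" where
  "J_op P z u x =
     (let L = len P; \<rho> = density z; v = velocity z; e = energy z; p = pressure P z;
          u1 = (\<lambda>y. u y $ 1); u2 = (\<lambda>y. u y $ 2); u3 = (\<lambda>y. u y $ 3);
          fr = fric P / (2 * diam P) * v x * \<bar>v x\<bar>
      in vector
        [- Dx L u2 x,
         - Dx L u1 x + (- fr * u3 x - gDg L (\<lambda>y. e y / \<rho> y) (\<lambda>y. 1) u3 x
                        - gDg L (\<lambda>y. 1 / \<rho> y) p u3 x),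
         fr * u2 x - gDg L (\<lambda>y. 1) (\<lambda>y. e y / \<rho> y) u2 x - gDg L p (\<lambda>y. 1 / \<rho> y) u2 x])"

definition effort :: "state \<Rightarrow> real \<Rightarrow> real^3" where
  "effort z x = vector [(velocity z x)\<^sup>2 / 2, density z x * velocity z x, 1]"

definition hamiltonian :: "real \<Rightarrow> state \<Rightarrow> real" where
  "hamiltonian L z =
     (LINT x|omega_measure L. density z x * ((velocity z x)\<^sup>2 / 2) + energy z x)"

definition has_variational_derivative ::
  "real \<Rightarrow> (state \<Rightarrow> real) \<Rightarrow> state \<Rightarrow> (real \<Rightarrow> real^3) \<Rightarrow> bool" where
  "has_variational_derivative L H z g \<longleftrightarrow> g \<in> cubed (Lsq L) \<and>
     (\<forall>w\<in>cubed (H1 L).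
        ((\<lambda>\<epsilon>. H (\<lambda>x. z x + \<epsilon> *\<^sub>R w x)) has_real_derivative
           (LINT x|omega_measure L. g x \<bullet> w x)) (at 0))"

definition dirac_set :: "pipe \<Rightarrow> state \<Rightarrow> (port \<times> port) set" where
  "dirac_set P z = {(f, e).
     let L = len P; \<rho> = density z; en = energy z; p = pressure P z;
         eS = port_S e; e1 = (\<lambda>x. eS x $ 1); e2 = (\<lambda>x. eS x $ 2); e3 = (\<lambda>x. eS x $ 3);
         h = (\<lambda>x. (en x + p x) / \<rho> x)
     in f \<in> port_space L \<and> e \<in> port_space L \<and>
        (\<lambda>x. p x * e3 x) \<in> H1 L \<and> (\<lambda>x. en x / \<rho> x * e2 x) \<in> H1 L \<and>
        (\<lambda>x. 1 / \<rho> x * e2 x) \<in> H1 L \<and>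
        (AE x in omega_measure L.
           port_S f x + (J_op P z eS x + port_R e x + port_P e x *\<^sub>R B_vec P) = 0 \<and>
           port_R f x - eS x = 0 \<and>
           port_P f x - B_vec P \<bullet> eS x = 0) \<and>
        port_B f = vector [- bdry_value L e2 L, bdry_value L e2 0] \<and>
        port_B e = vector [bdry_value L e1 L + bdry_value L h L * bdry_value L e3 L,
                           bdry_value L e1 0 + bdry_value L h 0 * bdry_value L e3 0]}"


section \<open>The evolution systems\<close>

text \<open>Here \<open>z t\<close> is the state at time \<open>t\<close>, and its time derivative at \<open>t\<close> is the limit of the
  difference quotients in \<open>L\<^sup>2(0,L)\<^sup>3\<close>, one-sided at an end point of the time interval \<open>I\<close>.\<close>

definition has_time_derivative ::
  "real \<Rightarrow> real set \<Rightarrow> (real \<Rightarrow> state) \<Rightarrow> real \<Rightarrow> (real \<Rightarrow> real^3) \<Rightarrow> bool" where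
  "has_time_derivative L I z t w \<longleftrightarrow> w \<in> cubed (Lsq L) \<and>
     ((\<lambda>s. LINT x|omega_measure L. (norm ((1 / (s - t)) *\<^sub>R (z s x - z t x) - w x))\<^sup>2)
        \<longlongrightarrow> 0) (at t within I)"

text \<open>\<open>z_t\<close> is the time derivative of the trajectory \<open>z\<close>.  That \<open>z_t t\<close> belongs to \<open>H1\<close> is what
  makes the flow \<open>- E(z) z_t\<close> an element of the flow space.\<close>

definition regular_trajectory ::
  "pipe \<Rightarrow> real set \<Rightarrow> (real \<Rightarrow> state) \<Rightarrow> (real \<Rightarrow> real \<Rightarrow> real^3) \<Rightarrow> bool" where
  "regular_trajectory P I z z_t \<longleftrightarrow>
     (\<forall>t\<in>I. admissible_state P (z t) \<and> has_time_derivative (len P) I z t (z_t t) \<and>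
        z_t t \<in> cubed (H1 (len P)))"

definition dirac_system ::
  "pipe \<Rightarrow> real set \<Rightarrow> (real \<Rightarrow> state) \<Rightarrow> (real \<Rightarrow> real \<Rightarrow> real^3) \<Rightarrow>
   (real \<Rightarrow> port) \<Rightarrow> (real \<Rightarrow> port) \<Rightarrow> bool" where
  "dirac_system P I z z_t f e \<longleftrightarrow> (\<forall>t\<in>I.
     (AE x in omega_measure (len P). port_S (f t) x = - (E_mat (z t) x *v z_t t x)) \<and>
     has_variational_derivative (len P) (hamiltonian (len P)) (z t) (port_S (e t)) \<and>
     (AE x in omega_measure (len P). port_R (e t) x = - (R_mat P (z t) x *v port_R (f t) x)) \<and>
     (AE x in omega_measure (len P). port_P (e t) x = T_amb P) \<and>
     (f t, e t) \<in> dirac_set P (z t))"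

definition port_hamiltonian_system ::
  "pipe \<Rightarrow> real set \<Rightarrow> (real \<Rightarrow> state) \<Rightarrow> (real \<Rightarrow> real \<Rightarrow> real^3) \<Rightarrow> (real \<Rightarrow> real \<Rightarrow> real) \<Rightarrow> bool"
  where
  "port_hamiltonian_system P I z z_t y \<longleftrightarrow> (\<forall>t\<in>I. AE x in omega_measure (len P).
     E_mat (z t) x *v z_t t x =
       (J_op P (z t) (effort (z t)) x - R_mat P (z t) x *v effort (z t) x) + T_amb P *\<^sub>R B_vec P \<and>
     y t x = B_vec P \<bullet> effort (z t) x)"

end

theory Submission
  imports Defs
begin

text \<open>The condition that the flow and the effort lie in the structure determines the resistive effort
  \<open>e\<^sub>R = - (f\<^sub>S + J e\<^sub>S
      + B e\<^sub>P)\<close>, so \<open>f\<^sub>S, e\<^sub>S \<in> H\<^sup>1\<close> and \<open>e\<^sub>P \<in> L\<^sup>2\<close> parametrize the structure freely.  Integration by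
  parts shows that \<open>J\<close> is skew-adjoint up to boundary terms, which the boundary ports cancel; hence the
  structure is isotropic.  Conversely, given an element of the orthogonal complement, subtract the member of the
  structure with the same \<open>f\<^sub>S, e\<^sub>S, e\<^sub>P\<close>.  By isotropy the difference is still orthogonal, but only its
  \<open>f\<^sub>R, f\<^sub>P, e\<^sub>R\<close> and boundary parts can be nonzero, and testing against the parametrized elements kills these one by
  one.  Linearity then comes for free from \<open>D = D\<^sup>\<bottom>\<close>, and the power balance is isotropy on the diagonal.

  Everything rests on \<open>H\<^sup>1(0,L)\<close> being the space of indefinite integrals of \<open>L\<^sup>2\<close> functions, an algebra that is closed
  under inversion of functions bounded away from zero.\<close>

section \<open>Square-integrable functions\<close>

text \<open>The flow \<open>f\<^sub>S\<close> lies in H1, whereas \<open>J e\<^sub>S\<close> is only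
  in L2. The resistive effort is an L2 port and absorbs this mismatch; otherwise the three
  parameters could not be prescribed independently. Skew-adjointness can be read off the transposed
  entries of \<open>J\<close>: \<open>e/\<rho> D_x\<close> stands opposite
  \<open>D_x e/\<rho>\<close>, \<open>1/\<rho> D_x p\<close> opposite \<open>p D_x 1/\<rho>\<close>,
  and friction is antisymmetric at each point. Integration by parts leaves traces with the
  coefficients \<open>e/\<rho>\<close> and \<open>p/\<rho>\<close>, whose sum is the enthalpy in the
  boundary effort. The delicate matter is the trace. Functions count only up to null sets, and
  \<open>Dx\<close> and \<open>cont_rep\<close> are arbitrary choices, so each boundary value has to
  be tied to a continuous representative, and identities involving \<open>Dx\<close> hold almost
  everywhere only. In the evolution systems the variational derivative is unique almost everywhere.
  This fixes \<open>e\<^sub>S\<close>, and the remaining ports are then those of the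
  parametrization.\<close>

lemma omega_measure_finite: "finite_measure (omega_measure L)"
  by (simp add: finite_measure_lebesgue_on)

text \<open>Extension by zero moves the question to Lebesgue measure on the whole space, whose
  completeness keeps functions measurable under changes on null sets.\<close>

lemma borel_measurable_lebesgue_on_AE:
  fixes f g :: "'a::euclidean_space \<Rightarrow> 'b::euclidean_space"
  assumes S: "S \<in> sets lebesgue" and f: "f \<in> borel_measurable (lebesgue_on S)"
    and ae: "AE x in lebesgue_on S. f x = g x"
  shows "g \<in> borel_measurable (lebesgue_on S)"
proof -
  have "(\<lambda>x. if x \<in> S then f x else 0) \<in> borel_measurable lebesgue"
    using borel_measurable_if[OF S] f by blast
  moreover have "AE x in lebesgue. x \<in> S \<longrightarrow> f x = g x"
    using ae S by (simp add: AE_restrict_space_iff)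
  then have "AE x in lebesgue. (if x \<in> S then f x else 0) = (if x \<in> S then g x else 0)"
    by eventually_elim auto
  ultimately have "(\<lambda>x. if x \<in> S then g x else 0) \<in> borel_measurable lebesgue"
    by (rule borel_measurable_AE)
  then show ?thesis
    using borel_measurable_if[OF S] by blast
qed

lemma Lsq_cong_AE:
  assumes "u \<in> Lsq L" "AE x in omega_measure L. u x = v x"
  shows "v \<in> Lsq L"
proof -
  have m: "v \<in> borel_measurable (omega_measure L)"
    by (rule borel_measurable_lebesgue_on_AE[of _ u]) (use assms in \<open>auto simp: Lsq_def\<close>)
  moreover have "integrable (omega_measure L) (\<lambda>x. (v x)\<^sup>2)"
    by (rule Bochner_Integration.integrable_cong_AE_imp[of _ "\<lambda>x. (u x)\<^sup>2"])
      (use assms m in \<open>auto simp: Lsq_def\<close>)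
  ultimately show ?thesis by (simp add: Lsq_def)
qed

text \<open>The product is dominated by \<open>u^2 + v^2\<close>, as expanding the square of the
  difference of absolute values shows.\<close>

lemma Lsq_mult_integrable:
  assumes "u \<in> Lsq L" "v \<in> Lsq L"
  shows "integrable (omega_measure L) (\<lambda>x. u x * v x)"
proof (rule Bochner_Integration.integrable_bound)
  show "integrable (omega_measure L) (\<lambda>x. (u x)\<^sup>2 + (v x)\<^sup>2)"
    using assms by (simp add: Lsq_def)
  show "AE x in omega_measure L. norm (u x * v x) \<le> norm ((u x)\<^sup>2 + (v x)\<^sup>2)"
  proof (intro AE_I2)
    fix x
    have "0 \<le> (\<bar>u x\<bar> - \<bar>v x\<bar>)\<^sup>2" "0 \<le> \<bar>u x\<bar> * \<bar>v x\<bar>" by auto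
    then have "\<bar>u x\<bar> * \<bar>v x\<bar> \<le> (u x)\<^sup>2 + (v x)\<^sup>2"
      unfolding power2_diff power2_abs by linarith
    then show "norm (u x * v x) \<le> norm ((u x)\<^sup>2 + (v x)\<^sup>2)"
      by (simp add: abs_mult)
  qed
qed (use assms in \<open>auto simp: Lsq_def\<close>)

lemma Lsq_const: "(\<lambda>x. c) \<in> Lsq L"
  by (simp add: Lsq_def finite_measure.integrable_const omega_measure_finite)

lemma Lsq_integrable: "u \<in> Lsq L \<Longrightarrow> integrable (omega_measure L) u"
  using Lsq_mult_integrable[OF Lsq_const[of 1], of u] by simp

lemma Lsq_add: "u \<in> Lsq L \<Longrightarrow> v \<in> Lsq L \<Longrightarrow> (\<lambda>x. u x + v x) \<in> Lsq L"
  using Lsq_mult_integrable[of u L v] by (auto simp: Lsq_def power2_sum mult.assoc)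

lemma Lsq_mult_bounded:
  assumes u: "u \<in> Lsq L" and v: "v \<in> borel_measurable (omega_measure L)"
    and b: "AE x in omega_measure L. \<bar>v x\<bar> \<le> C"
  shows "(\<lambda>x. v x * u x) \<in> Lsq L"
proof -
  have "integrable (omega_measure L) (\<lambda>x. (v x * u x)\<^sup>2)"
  proof (rule Bochner_Integration.integrable_bound)
    show "integrable (omega_measure L) (\<lambda>x. C\<^sup>2 * (u x)\<^sup>2)"
      using u by (simp add: Lsq_def)
    show "AE x in omega_measure L. norm ((v x * u x)\<^sup>2) \<le> norm (C\<^sup>2 * (u x)\<^sup>2)"
      using b
    proof eventually_elim
      case (elim x)
      then have "(v x)\<^sup>2 \<le> C\<^sup>2" by (metis abs_ge_zero power2_abs power_mono)
      then show ?case by (simp add: power_mult_distrib mult_right_mono)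
    qed
    show "(\<lambda>x. (v x * u x)\<^sup>2) \<in> borel_measurable (omega_measure L)"
      using u v by (auto simp: Lsq_def)
  qed
  then show ?thesis using u v by (auto simp: Lsq_def intro!: borel_measurable_times)
qed

lemma Lsq_cmult: "u \<in> Lsq L \<Longrightarrow> (\<lambda>x. c * u x) \<in> Lsq L"
  by (rule Lsq_mult_bounded[of _ _ _ "\<bar>c\<bar>"]) auto

lemma Lsq_uminus: "u \<in> Lsq L \<Longrightarrow> (\<lambda>x. - u x) \<in> Lsq L"
  using Lsq_cmult[of u L "-1"] by simp

lemma Lsq_diff: "u \<in> Lsq L \<Longrightarrow> v \<in> Lsq L \<Longrightarrow> (\<lambda>x. u x - v x) \<in> Lsq L"
  using Lsq_add[of u L "\<lambda>x. - v x"] by (simp add: Lsq_uminus)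

section \<open>Absolutely continuous functions\<close>

text \<open>The pairs \<open>(w, g)\<close> with \<open>w\<close> absolutely continuous on \<open>[0,L]\<close> and \<open>g = w'\<close>.\<close>

definition primitive_on :: "real \<Rightarrow> (real \<Rightarrow> real) \<Rightarrow> (real \<Rightarrow> real) \<Rightarrow> bool" where
  "primitive_on L w g \<longleftrightarrow> g absolutely_integrable_on {0..L} \<and>
     (\<forall>x\<in>{0..L}. w x = w 0 + integral {0..x} g)"

lemma primitive_on_integrable: "primitive_on L w g \<Longrightarrow> g absolutely_integrable_on {0..L}"
  and primitive_on_eq: "primitive_on L w g \<Longrightarrow> x \<in> {0..L} \<Longrightarrow> w x = w 0 + integral {0..x} g"
  unfolding primitive_on_def by blast+

lemma primitive_on_increment:
  assumes "primitive_on L w g" "0 \<le> x" "x \<le> y" "y \<le> L"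
  shows "g absolutely_integrable_on {x..y}" "w y - w x = integral {x..y} g"
proof -
  have a: "g absolutely_integrable_on {0..L}" using assms(1) by (rule primitive_on_integrable)
  show "g absolutely_integrable_on {x..y}"
    by (rule absolutely_integrable_on_subinterval[OF a]) (use assms in auto)
  have "g absolutely_integrable_on {0..y}"
    by (rule absolutely_integrable_on_subinterval[OF a]) (use assms in auto)
  then have "g integrable_on {0..y}" by (rule set_lebesgue_integral_eq_integral(1)) 
  then have "integral {0..x} g + integral {x..y} g = integral {0..y} g"
    using assms by (intro Henstock_Kurzweil_Integration.integral_combine) auto
  then show "w y - w x = integral {x..y} g"
    using primitive_on_eq[OF assms(1), of x] primitive_on_eq[OF assms(1), of y] assms by simp
qed

lemma primitive_on_continuous:
  assumes "primitive_on L w g"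
  shows "continuous_on {0..L} w"
proof -
  have "g integrable_on {0..L}"
    using primitive_on_integrable[OF assms] by (rule set_lebesgue_integral_eq_integral(1))
  then have "continuous_on {0..L} (\<lambda>x. w 0 + integral {0..x} g)"
    by (intro continuous_intros indefinite_integral_continuous_1)
  then show ?thesis
    by (rule continuous_on_eq) (rule primitive_on_eq[OF assms, symmetric])
qed

text \<open>A form of the fundamental theorem that needs no pointwise differentiation of \<open>W\<close>: the defect
  \<open>W y - W x - \<integral>\<^sub>x\<^sup>y k\<close> is additive in the interval, so local smallness relative to an integrable
  density makes it vanish.\<close>

lemma primitive_onI_local:
  assumes L: "0 \<le> L" and k: "k absolutely_integrable_on {0..L}"
    and a: "a integrable_on {0..L}"
    and loc: "\<And>x \<epsilon>. x \<in> {0..L} \<Longrightarrow> 0 < \<epsilon> \<Longrightarrow> \<exists>d>0. \<forall>s t. 0 \<le> s \<and> s \<le> x \<and> x \<le> t \<and> t \<le> L \<and> t - s < d \<longrightarrow>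
        \<bar>W t - W s - integral {s..t} k\<bar> \<le> \<epsilon> * integral {s..t} a"
  shows "primitive_on L W k"
proof -
  have ki: "k integrable_on {0..L}" using k by (rule set_lebesgue_integral_eq_integral(1))
  have *: "\<bar>W b - W 0 - integral {0..b} k\<bar> \<le> \<epsilon> * integral {0..b} a"
    if e: "0 < \<epsilon>" and b: "0 \<le> b" "b \<le> L" for \<epsilon> b
  proof -
    \<comment> \<open>The bounds on \<open>s\<close> and \<open>t\<close> are premises inside
      \<open>?P\<close>, because the bisection rule also asks for small intervals around
      \<open>x\<close> that stick out of \<open>[0,L]\<close>.\<close>
    let ?P = "\<lambda>s t. 0 \<le> s \<longrightarrow> s \<le> t \<longrightarrow> t \<le> L \<longrightarrow> \<bar>W t - W s - integral {s..t} k\<bar> \<le> \<epsilon> * integral {s..t} a"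
    have "?P 0 b"
    proof (rule Bolzano[where P = "?P"])
      fix s t u assume trans: "?P s t" "?P t u" "s \<le> t" "t \<le> u"
      show "?P s u"
      proof (intro impI)
        assume h: "0 \<le> s" "s \<le> u" "u \<le> L"
        have sub: "{s..u} \<subseteq> {0..L}" using h by auto
        have "integral {s..t} k + integral {t..u} k = integral {s..u} k"
          by (intro Henstock_Kurzweil_Integration.integral_combine trans(3,4)
              integrable_on_subinterval[OF ki] sub)
        moreover have "integral {s..t} a + integral {t..u} a = integral {s..u} a"
          by (intro Henstock_Kurzweil_Integration.integral_combine trans(3,4)
              integrable_on_subinterval[OF a] sub)
        then have "\<epsilon> * integral {s..t} a + \<epsilon> * integral {t..u} a = \<epsilon> * integral {s..u} a"
          by (metis distrib_left)
        ultimately show "\<bar>W u - W s - integral {s..u} k\<bar> \<le> \<epsilon> * integral {s..u} a"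
          using trans h by linarith
      qed
    next
      fix x assume "0 \<le> x" "x \<le> b"
      then obtain d where "d > 0" "\<forall>s t. 0 \<le> s \<and> s \<le> x \<and> x \<le> t \<and> t \<le> L \<and> t - s < d \<longrightarrow>
        \<bar>W t - W s - integral {s..t} k\<bar> \<le> \<epsilon> * integral {s..t} a"
        using loc[OF _ e, of x] b by auto
      then show "\<exists>d>0. \<forall>s t. s \<le> x \<and> x \<le> t \<and> t - s < d \<longrightarrow> ?P s t"
        by (intro exI[of _ d]) auto
    qed (use b in simp)
    then show ?thesis using b by auto
  qed
  have "W b - W 0 - integral {0..b} k = 0" if b: "b \<in> {0..L}" for b
  proof -
    have "\<bar>W b - W 0 - integral {0..b} k\<bar> \<le> 0 + \<epsilon>" if e: "0 < \<epsilon>" for \<epsilon>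
    proof -
      \<comment> \<open>The summand 1 keeps the divisor positive even when the integral of
        \<open>a\<close> vanishes.\<close>
      define A where "A = \<bar>integral {0..b} a\<bar> + 1"
      have A: "A > 0" "integral {0..b} a \<le> A" by (auto simp: A_def)
      have "\<bar>W b - W 0 - integral {0..b} k\<bar> \<le> \<epsilon> / A * integral {0..b} a"
        using *[of "\<epsilon> / A" b] e A b by auto
      also have "\<dots> \<le> \<epsilon> / A * A" using A e by (intro mult_left_mono) auto
      finally show ?thesis using A by simp
    qed
    then have "\<bar>W b - W 0 - integral {0..b} k\<bar> \<le> 0" by (rule field_le_epsilon)
    then show ?thesis by simp
  qed
  then have "W b = W 0 + integral {0..b} k" if "b \<in> {0..L}" for b
    using that by (simp only: diff_diff_eq right_minus_eq)
  then show ?thesis using k unfolding primitive_on_def by blast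
qed

lemma continuous_on_local_oscillation:
  fixes u :: "real \<Rightarrow> real"
  assumes "continuous_on {0..L} u" "x \<in> {0..L}" "0 < \<epsilon>"
  obtains d where "0 < d"
    "\<And>s t p q. 0 \<le> s \<Longrightarrow> s \<le> x \<Longrightarrow> x \<le> t \<Longrightarrow> t \<le> L \<Longrightarrow> t - s < d \<Longrightarrow> p \<in> {s..t} \<Longrightarrow> q \<in> {s..t} \<Longrightarrow> \<bar>u p - u q\<bar> < \<epsilon>"
proof -
  obtain d where d: "0 < d" "\<And>s. s \<in> {0..L} \<Longrightarrow> dist s x < d \<Longrightarrow> dist (u s) (u x) < \<epsilon> / 2"
    using assms unfolding continuous_on_iff by (metis half_gt_zero)
  show thesis
  proof (rule that[OF d(1)])
    fix s t p q assume *: "0 \<le> s" "s \<le> x" "x \<le> t" "t \<le> L" "t - s < d" "p \<in> {s..t}" "q \<in> {s..t}"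
    have "dist p x < d" "dist q x < d" using * by (auto simp: dist_real_def abs_if)
    then have "\<bar>u p - u x\<bar> < \<epsilon> / 2" "\<bar>u q - u x\<bar> < \<epsilon> / 2"
      using d(2)[of p] d(2)[of q] * by (auto simp: dist_real_def)
    then show "\<bar>u p - u q\<bar> < \<epsilon>" using abs_triangle_ineq4[of "u p - u x" "u q - u x"] by simp
  qed
qed

lemma absolutely_integrable_continuous_mult:
  fixes u g :: "real \<Rightarrow> real"
  assumes "continuous_on {a..b} u" "g absolutely_integrable_on {a..b}"
  shows "(\<lambda>x. u x * g x) absolutely_integrable_on {a..b}"
  using assms
  by (intro absolutely_integrable_bounded_measurable_product_real
      continuous_imp_measurable_on_sets_lebesgue compact_imp_bounded compact_continuous_image) auto

text \<open>On a short interval the increment of the product is the integral of \<open>g\<close> and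
  \<open>h\<close> with the factors frozen at end points. Freezing costs at most the oscillation of
  \<open>u\<close> and \<open>v\<close>, which continuity makes small, times
  \<open>\<bar>g\<bar> + \<bar>h\<bar>\<close>; this is the density of the local criterion.\<close>

lemma primitive_on_mult:
  assumes L: "0 \<le> L" and u: "primitive_on L u g" and v: "primitive_on L v h"
  shows "primitive_on L (\<lambda>x. u x * v x) (\<lambda>x. u x * h x + v x * g x)"
proof (rule primitive_onI_local[OF L, where a = "\<lambda>x. \<bar>g x\<bar> + \<bar>h x\<bar>"])
  note cu = primitive_on_continuous[OF u] and cv = primitive_on_continuous[OF v]
  have g: "g absolutely_integrable_on {0..L}" and h: "h absolutely_integrable_on {0..L}"
    using primitive_on_integrable u v by blast+
  have uh: "(\<lambda>x. u x * h x) absolutely_integrable_on {0..L}" and vg: "(\<lambda>x. v x * g x) absolutely_integrable_on {0..L}"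
    using absolutely_integrable_continuous_mult cu cv g h by auto
  show k: "(\<lambda>x. u x * h x + v x * g x) absolutely_integrable_on {0..L}"
    by (intro set_integral_add uh vg)
  have ag: "(\<lambda>x. \<bar>g x\<bar>) integrable_on {0..L}" and ah: "(\<lambda>x. \<bar>h x\<bar>) integrable_on {0..L}"
    using g h by (auto simp: absolutely_integrable_on_def)
  show "(\<lambda>x. \<bar>g x\<bar> + \<bar>h x\<bar>) integrable_on {0..L}" by (intro integrable_add ag ah)
  fix x and \<epsilon> :: real assume x: "x \<in> {0..L}" and e: "0 < \<epsilon>"
  obtain d1 where d1: "0 < d1" "\<And>s t p q. 0 \<le> s \<Longrightarrow> s \<le> x \<Longrightarrow> x \<le> t \<Longrightarrow> t \<le> L \<Longrightarrow> t - s < d1 \<Longrightarrow> p \<in> {s..t} \<Longrightarrow>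
      q \<in> {s..t} \<Longrightarrow> \<bar>u p - u q\<bar> < \<epsilon>"
    using continuous_on_local_oscillation[OF cu x e] by metis
  obtain d2 where d2: "0 < d2" "\<And>s t p q. 0 \<le> s \<Longrightarrow> s \<le> x \<Longrightarrow> x \<le> t \<Longrightarrow> t \<le> L \<Longrightarrow> t - s < d2 \<Longrightarrow> p \<in> {s..t} \<Longrightarrow>
      q \<in> {s..t} \<Longrightarrow> \<bar>v p - v q\<bar> < \<epsilon>"
    using continuous_on_local_oscillation[OF cv x e] by metis
  show "\<exists>d>0. \<forall>s t. 0 \<le> s \<and> s \<le> x \<and> x \<le> t \<and> t \<le> L \<and> t - s < d \<longrightarrow>
        \<bar>u t * v t - u s * v s - integral {s..t} (\<lambda>x. u x * h x + v x * g x)\<bar>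
          \<le> \<epsilon> * integral {s..t} (\<lambda>x. \<bar>g x\<bar> + \<bar>h x\<bar>)"
  proof (intro exI[of _ "min d1 d2"] conjI allI impI)
    fix s t assume *: "0 \<le> s \<and> s \<le> x \<and> x \<le> t \<and> t \<le> L \<and> t - s < min d1 d2"
    then have sub: "{s..t} \<subseteq> {0..L}" by auto
    note int = integrable_on_subinterval[OF _ sub]
    have gi: "g integrable_on {s..t}" and hi: "h integrable_on {s..t}" and ki: "(\<lambda>x. u x * h x
        + v x * g x) integrable_on {s..t}"
      by (intro int set_lebesgue_integral_eq_integral(1)[OF g] set_lebesgue_integral_eq_integral(1)[OF h]
          set_lebesgue_integral_eq_integral(1)[OF k])+
    have mi: "(\<lambda>r. g r * v t + u s * h r) integrable_on {s..t}"
      by (intro integrable_add integrable_on_mult_left integrable_on_mult_right gi hi)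
    \<comment> \<open>An exact splitting: \<open>v\<close> is frozen at the right end and
      \<open>u\<close> at the left end, so no quadratic remainder appears.\<close>
    have "u t * v t - u s * v s = (u t - u s) * v t + u s * (v t - v s)" by algebra
    also have "\<dots> = integral {s..t} g * v t + u s * integral {s..t} h"
      using primitive_on_increment(2)[OF u, of s t] primitive_on_increment(2)[OF v, of s t] * by simp
    also have "\<dots> = integral {s..t} (\<lambda>r. g r * v t + u s * h r)"
      by (intro integral_unique[symmetric] has_integral_add has_integral_mult_left
          has_integral_mult_right integrable_integral gi hi)
    finally have "u t * v t - u s * v s - integral {s..t} (\<lambda>x. u x * h x + v x * g x)
        = integral {s..t} (\<lambda>r. (g r * v t + u s * h r) - (u r * h r + v r * g r))"
      by (subst integral_diff[OF mi ki]) simp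
    also have "norm \<dots> \<le> integral {s..t} (\<lambda>r. \<epsilon> * (\<bar>g r\<bar> + \<bar>h r\<bar>))"
    proof (rule integral_norm_bound_integral)
      show "(\<lambda>r. (g r * v t + u s * h r) - (u r * h r + v r * g r)) integrable_on {s..t}"
        by (intro integrable_diff mi ki)
      show "(\<lambda>r. \<epsilon> * (\<bar>g r\<bar> + \<bar>h r\<bar>)) integrable_on {s..t}"
        by (intro integrable_on_mult_right integrable_add int ag ah)
      fix r assume r: "r \<in> {s..t}"
      have "\<bar>v t - v r\<bar> \<le> \<epsilon>" "\<bar>u s - u r\<bar> \<le> \<epsilon>"
        using r * d1(2)[of s t s r] d2(2)[of s t t r] by auto
      then have "\<bar>g r\<bar> * \<bar>v t - v r\<bar> \<le> \<bar>g r\<bar> * \<epsilon>" "\<bar>h r\<bar> * \<bar>u s - u r\<bar> \<le> \<bar>h r\<bar> * \<epsilon>"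
        by (auto intro: mult_left_mono)
      moreover have eq: "(g r * v t + u s * h r) - (u r * h r + v r * g r) = g r * (v t - v r)
          + h r * (u s - u r)"
        by algebra
      moreover have "norm (g r * (v t - v r) + h r * (u s - u r)) \<le> \<bar>g r\<bar> * \<bar>v t - v r\<bar>
          + \<bar>h r\<bar> * \<bar>u s - u r\<bar>"
        by (metis abs_mult abs_triangle_ineq real_norm_def)
      moreover have "\<epsilon> * (\<bar>g r\<bar> + \<bar>h r\<bar>) = \<bar>g r\<bar> * \<epsilon> + \<bar>h r\<bar> * \<epsilon>" by algebra
      ultimately show "norm ((g r * v t + u s * h r) - (u r * h r + v r * g r)) \<le> \<epsilon> * (\<bar>g r\<bar> + \<bar>h r\<bar>)"
        unfolding eq by linarith
    qed
    finally show "\<bar>u t * v t - u s * v s - integral {s..t} (\<lambda>x. u x * h x + v x * g x)\<bar>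
          \<le> \<epsilon> * integral {s..t} (\<lambda>x. \<bar>g x\<bar> + \<bar>h x\<bar>)"
      by simp
  qed (use d1 d2 in auto)
qed

text \<open>The increment of the reciprocal \<open>i\<close> is exactly \<open>- (i s * i t)\<close>
  times that of \<open>w\<close>. Replacing \<open>i s * i t\<close> by the square of
  \<open>i r\<close> costs only the oscillation of \<open>i\<close>, so \<open>\<bar>g\<bar>\<close>
  serves as density.\<close>

lemma primitive_on_inverse:
  assumes L: "0 \<le> L" and w: "primitive_on L w g" and c: "0 < c" "\<And>x. x \<in> {0..L} \<Longrightarrow> c \<le> w x"
  shows "primitive_on L (\<lambda>x. inverse (w x)) (\<lambda>x. - (inverse (w x))\<^sup>2 * g x)"
proof (rule primitive_onI_local[OF L, where a = "\<lambda>x. \<bar>g x\<bar>"])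
  define i where "i x = inverse (w x)" for x
  note cw = primitive_on_continuous[OF w]
  have ci: "continuous_on {0..L} i"
    unfolding i_def using c by (intro continuous_intros cw) force
  have ib: "\<bar>i x\<bar> \<le> inverse c" and iw: "i x * w x = 1" if "x \<in> {0..L}" for x
    using c(1) c(2)[OF that] by (auto simp: i_def intro!: le_imp_inverse_le)
  have g: "g absolutely_integrable_on {0..L}" using w by (rule primitive_on_integrable)
  show k: "(\<lambda>x. - (inverse (w x))\<^sup>2 * g x) absolutely_integrable_on {0..L}"
    unfolding i_def[symmetric] by (intro absolutely_integrable_continuous_mult g continuous_intros ci)
  show ag: "(\<lambda>x. \<bar>g x\<bar>) integrable_on {0..L}"
    using g by (auto simp: absolutely_integrable_on_def)
  fix x and \<epsilon> :: real assume x: "x \<in> {0..L}" and e: "0 < \<epsilon>"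
  \<comment> \<open>The defect will be a sum of two products, each of a value of \<open>i\<close>,
    bounded by \<open>inverse c\<close>, and an oscillation. With this bound each contributes at
    most half of \<open>\<epsilon>\<close>.\<close>
  have "0 < \<epsilon> * c / 2" using e c by simp
  then obtain d where d: "0 < d" "\<And>s t p q. 0 \<le> s \<Longrightarrow> s \<le> x \<Longrightarrow> x \<le> t \<Longrightarrow> t \<le> L \<Longrightarrow> t - s < d \<Longrightarrow>
      p \<in> {s..t} \<Longrightarrow> q \<in> {s..t} \<Longrightarrow> \<bar>i p - i q\<bar> < \<epsilon> * c / 2"
    using continuous_on_local_oscillation[OF ci x] by metis
  show "\<exists>d>0. \<forall>s t. 0 \<le> s \<and> s \<le> x \<and> x \<le> t \<and> t \<le> L \<and> t - s < d \<longrightarrow>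
        \<bar>inverse (w t) - inverse (w s) - integral {s..t} (\<lambda>x. - (inverse (w x))\<^sup>2 * g x)\<bar>
          \<le> \<epsilon> * integral {s..t} (\<lambda>x. \<bar>g x\<bar>)"
  proof (intro exI[of _ d] conjI allI impI)
    fix s t assume *: "0 \<le> s \<and> s \<le> x \<and> x \<le> t \<and> t \<le> L \<and> t - s < d"
    then have sub: "{s..t} \<subseteq> {0..L}" by auto
    note int = integrable_on_subinterval[OF _ sub]
    have gi: "g integrable_on {s..t}" and ki: "(\<lambda>x. - (i x)\<^sup>2 * g x) integrable_on {s..t}"
      unfolding i_def
      by (intro int set_lebesgue_integral_eq_integral(1)[OF g] set_lebesgue_integral_eq_integral(1)[OF k])+
    have mi: "(\<lambda>r. - (i s * i t) * g r) integrable_on {s..t}"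
      by (intro integrable_on_mult_right gi)
    have "i t - i s = - (i s * i t) * (w t - w s)"
      using iw[of s] iw[of t] * by (auto simp: algebra_simps)
    also have "\<dots> = integral {s..t} (\<lambda>r. - (i s * i t) * g r)"
      using primitive_on_increment(2)[OF w, of s t] * by simp
    finally have "i t - i s - integral {s..t} (\<lambda>x. - (i x)\<^sup>2 * g x)
        = integral {s..t} (\<lambda>r. - (i s * i t) * g r - - (i r)\<^sup>2 * g r)"
      by (subst integral_diff[OF mi ki]) simp
    also have "norm \<dots> \<le> integral {s..t} (\<lambda>r. \<epsilon> * \<bar>g r\<bar>)"
    proof (rule integral_norm_bound_integral)
      show "(\<lambda>r. - (i s * i t) * g r - - (i r)\<^sup>2 * g r) integrable_on {s..t}"
        by (intro integrable_diff mi ki)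
      show "(\<lambda>r. \<epsilon> * \<bar>g r\<bar>) integrable_on {s..t}"
        by (intro integrable_on_mult_right int ag)
      fix r assume r: "r \<in> {s..t}"
      have "- (i s * i t) * g r - - (i r)\<^sup>2 * g r = (i r * (i r - i s) + i s * (i r - i t)) * g r"
        by (simp add: algebra_simps power2_eq_square)
      moreover have "\<bar>i r * (i r - i s) + i s * (i r - i t)\<bar> \<le> \<epsilon>"
      proof -
        have "\<bar>i r - i s\<bar> \<le> \<epsilon> * c / 2" "\<bar>i r - i t\<bar> \<le> \<epsilon> * c / 2"
          using r * d(2)[of s t r s] d(2)[of s t r t] by auto
        moreover have "\<bar>i r\<bar> \<le> inverse c" "\<bar>i s\<bar> \<le> inverse c"
          using r * by (auto intro!: ib)
        ultimately have "\<bar>i r * (i r - i s)\<bar> \<le> inverse c * (\<epsilon> * c / 2)" "\<bar>i s * (i r - i t)\<bar>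
            \<le> inverse c * (\<epsilon> * c / 2)"
          unfolding abs_mult using c(1) by (intro mult_mono; simp)+
        moreover have "inverse c * (\<epsilon> * c / 2) = \<epsilon> / 2" using c(1) by (simp add: field_simps)
        ultimately show ?thesis by linarith
      qed
      ultimately show "norm (- (i s * i t) * g r - - (i r)\<^sup>2 * g r) \<le> \<epsilon> * \<bar>g r\<bar>"
        by (simp add: abs_mult mult_right_mono)
    qed
    finally show "\<bar>inverse (w t) - inverse (w s) - integral {s..t} (\<lambda>x. - (inverse (w x))\<^sup>2 * g x)\<bar>
          \<le> \<epsilon> * integral {s..t} (\<lambda>x. \<bar>g x\<bar>)"
      by (simp add: i_def)
  qed (use d in auto)
qed

section \<open>Lebesgue integrals on the open interval as gauge integrals on its closure\<close>

lemma sets_omega_measure: "A \<in> sets lebesgue \<Longrightarrow> A \<inter> {0<..<L} \<in> sets (omega_measure L)"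
  by (auto simp: sets_restrict_space)

lemma integrable_omega_measure_iff:
  fixes f :: "real \<Rightarrow> real"
  shows "integrable (omega_measure L) f \<longleftrightarrow> f absolutely_integrable_on {0..L}"
  by (simp add: absolutely_integrable_on_Icc_iff_Ioo set_integrable_eq)

lemma integral_omega_measure:
  fixes f :: "real \<Rightarrow> real"
  shows "integrable (omega_measure L) f \<Longrightarrow> (LINT x|omega_measure L. f x) = integral {0..L} f"
  by (simp add: lebesgue_integral_eq_integral integral_open_interval_real)

lemma AE_omega_measure_I: "(\<And>x. 0 < x \<Longrightarrow> x < L \<Longrightarrow> Q x) \<Longrightarrow> AE x in omega_measure L. Q x"
  by (rule AE_I2) simp

lemma continuous_on_Icc_abs_bounded:
  fixes f :: "real \<Rightarrow> real"
  assumes "continuous_on {a..b} f"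
  obtains C where "\<And>x. x \<in> {a..b} \<Longrightarrow> \<bar>f x\<bar> \<le> C"
proof -
  have "bounded (f ` {a..b})"
    using assms by (intro compact_imp_bounded compact_continuous_image) auto
  then show ?thesis using that unfolding bounded_real by blast
qed

lemma continuous_on_Lsq:
  assumes "continuous_on {0..L} w"
  shows "w \<in> Lsq L"
proof -
  obtain C where C: "\<And>x. x \<in> {0..L} \<Longrightarrow> \<bar>w x\<bar> \<le> C"
    using continuous_on_Icc_abs_bounded[OF assms] by blast
  have "w \<in> borel_measurable (omega_measure L)"
    by (rule continuous_imp_measurable_on_sets_lebesgue) (auto intro: continuous_on_subset[OF assms])
  then have "(\<lambda>x. w x * 1) \<in> Lsq L"
    by (rule Lsq_mult_bounded[OF Lsq_const, of _ _ C]) (auto intro!: AE_omega_measure_I C)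
  then show ?thesis by simp
qed

section \<open>The fundamental lemma of the calculus of variations\<close>

lemma test_functions_C1:
  assumes "\<phi> \<in> test_functions L"
  shows "(\<phi> has_real_derivative deriv \<phi> x) (at x)" "continuous_on S (deriv \<phi>)" "continuous_on S \<phi>"
proof -
  obtain D where D: "\<And>x. (\<phi> has_vector_derivative D x) (at x)" "continuous_on UNIV D"
    using assms by (auto simp: test_functions_def C1_differentiable_on_def)
  then have d: "(\<phi> has_real_derivative D x) (at x)" for x
    by (simp add: has_real_derivative_iff_has_vector_derivative)
  then have "deriv \<phi> = D" by (auto intro!: DERIV_imp_deriv)
  then show "(\<phi> has_real_derivative deriv \<phi> x) (at x)" "continuous_on S (deriv \<phi>)"
    using d D by (auto intro: continuous_on_subset)
  show "continuous_on S \<phi>" using d by (meson DERIV_continuous_on has_field_derivative_at_within)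
qed

lemma compact_subset_interval:
  assumes "compact K" "K \<subseteq> {0<..<L::real}" "0 < L"
  obtains a b where "0 < a" "a < b" "b < L" "K \<subseteq> {a..b}"
proof (cases "K = {}")
  case True
  show ?thesis by (rule that[of "L/3" "L/2"]) (use True assms in auto)
next
  case False
  obtain s t where "s \<in> K" "\<And>x. x \<in> K \<Longrightarrow> s \<le> x" "t \<in> K" "\<And>x. x \<in> K \<Longrightarrow> x \<le> t"
    using compact_attains_inf[OF assms(1) False] compact_attains_sup[OF assms(1) False] by metis
  \<comment> \<open>Moving the extreme points of \<open>K\<close> halfway towards 0 and
    \<open>L\<close> gives a nondegenerate interval even if \<open>K\<close> is a single
    point.\<close>
  then show ?thesis using assms by (intro that[of "s/2" "(t+L)/2"]) fastforce+
qed

lemma test_functionsI: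
  assumes "\<And>x. (\<phi> has_real_derivative D x) (at x)" "continuous_on UNIV D"
    and "compact K" "K \<subseteq> {0<..<L}" "\<And>x. x \<notin> K \<Longrightarrow> \<phi> x = 0"
  shows "\<phi> \<in> test_functions L"
  using assms unfolding test_functions_def C1_differentiable_on_def has_real_derivative_iff_has_vector_derivative
  by blast

lemma test_functions_support:
  assumes "\<phi> \<in> test_functions L" "0 < L"
  obtains a b where "0 < a" "a < b" "b < L" "\<And>x. x \<notin> {a..b} \<Longrightarrow> \<phi> x = 0"
  using assms compact_subset_interval unfolding test_functions_def
      by (smt (verit) mem_Collect_eq subsetD)

lemma test_functions_Lsq: "\<phi> \<in> test_functions L \<Longrightarrow> \<phi> \<in> Lsq L" "\<phi> \<in> test_functions L \<Longrightarrow> deriv \<phi> \<in> Lsq L"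
  by (simp_all add: continuous_on_Lsq test_functions_C1)

text \<open>Squaring the positive part makes the function C1 at 0, as smooth as test functions have
  to be. It stays below 1 and reaches it only at infinity, which suits a use through dominated
  convergence.\<close>

definition smooth_step :: "real \<Rightarrow> real" where
  "smooth_step s = (max 0 s)\<^sup>2 / (1 + (max 0 s)\<^sup>2)"

lemma has_real_derivative_max_0_power2: "((\<lambda>s::real. (max 0 s)\<^sup>2) has_real_derivative 2 * max 0 s) (at s)"
proof -
  consider "s < 0" | "s > 0" | "s = 0" by linarith
  then show ?thesis
  proof cases
    case 1
    have "((\<lambda>s::real. 0) has_real_derivative 0) (at s)" by simp
    then have "((\<lambda>s::real. (max 0 s)\<^sup>2) has_real_derivative 0) (at s)"
      by (rule has_field_derivative_transform_within_open[where S="{..<0}"]) (use 1 in auto)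
    then show ?thesis using 1 by simp
  next
    case 2
    have "((\<lambda>s::real. s\<^sup>2) has_real_derivative 2 * s) (at s)"
      by (auto intro!: derivative_eq_intros)
    then have "((\<lambda>s::real. (max 0 s)\<^sup>2) has_real_derivative 2 * s) (at s)"
      by (rule has_field_derivative_transform_within_open[where S="{0<..}"]) (use 2 in auto)
    then show ?thesis using 2 by simp
  next
    case 3
    have "((\<lambda>y::real. (max 0 y)\<^sup>2 / y) \<longlongrightarrow> 0) (at 0)"
    proof (rule Lim_null_comparison)
      show "\<forall>\<^sub>F y::real in at 0. norm ((max 0 y)\<^sup>2 / y) \<le> \<bar>y\<bar>"
        by (rule always_eventually) (auto simp: max_def power2_eq_square)
      show "((\<lambda>y::real. \<bar>y\<bar>) \<longlongrightarrow> 0) (at 0)"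
        by (rule tendsto_rabs_zero) (rule tendsto_ident_at)
    qed
    then show ?thesis using 3 by (simp add: has_field_derivative_iff)
  qed
qed

lemma smooth_step_C1:
  "(smooth_step has_real_derivative 2 * max 0 s / (1 + (max 0 s)\<^sup>2)\<^sup>2) (at s)"
proof -
  define m where "m = max 0 s"
  have pos: "1 + m\<^sup>2 \<noteq> 0" by (smt (verit) zero_le_power2)
  have "((\<lambda>s. (max 0 s)\<^sup>2 / (1 + (max 0 s)\<^sup>2)) has_real_derivative
      (2 * m * (1 + m\<^sup>2) - m\<^sup>2 * (0 + 2 * m)) / ((1 + m\<^sup>2) * (1 + m\<^sup>2))) (at s)"
    unfolding m_def
    by (intro DERIV_divide DERIV_add DERIV_const has_real_derivative_max_0_power2 pos[unfolded m_def])
  also have "(2 * m * (1 + m\<^sup>2) - m\<^sup>2 * (0 + 2 * m)) / ((1 + m\<^sup>2) * (1 + m\<^sup>2)) = 2 * m / (1 + m\<^sup>2)\<^sup>2"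
    by (simp add: power2_eq_square algebra_simps)
  finally have "((\<lambda>s. (max 0 s)\<^sup>2 / (1 + (max 0 s)\<^sup>2)) has_real_derivative
      2 * max 0 s / (1 + (max 0 s)\<^sup>2)\<^sup>2) (at s)"
    unfolding m_def .
  then show ?thesis by (simp add: smooth_step_def[abs_def])
qed

lemma smooth_step_bounds: "0 \<le> smooth_step s" "smooth_step s \<le> 1" and smooth_step_eq_0: "s \<le> 0 \<Longrightarrow>
    smooth_step s = 0"
  by (auto simp: smooth_step_def divide_le_eq add_nonneg_eq_0_iff) (smt (verit) zero_le_power2)

lemma smooth_step_tendsto: "filterlim f at_top F \<Longrightarrow> ((\<lambda>x. smooth_step (f x)) \<longlongrightarrow> 1) F"
proof -
  have "(smooth_step \<longlongrightarrow> 1) at_top"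
  proof (rule Lim_transform_eventually)
    have "((\<lambda>s::real. 1 - inverse (1 + s\<^sup>2)) \<longlongrightarrow> 1 - 0) at_top"
      by (intro tendsto_diff tendsto_const tendsto_inverse_0_at_top
          filterlim_tendsto_add_at_top[OF tendsto_const] filterlim_pow_at_top filterlim_ident) auto
    then show "((\<lambda>s::real. 1 - inverse (1 + s\<^sup>2)) \<longlongrightarrow> 1) at_top" by simp
    show "\<forall>\<^sub>F s in at_top. 1 - inverse (1 + s\<^sup>2) = smooth_step s"
      using eventually_ge_at_top[of 0]
    proof eventually_elim
      case (elim s)
      have "1 + s\<^sup>2 \<noteq> 0" by (smt (verit) zero_le_power2)
      then show ?case using elim by (simp add: smooth_step_def field_simps)
    qed
  qed
  then show "filterlim f at_top F \<Longrightarrow> ((\<lambda>x. smooth_step (f x)) \<longlongrightarrow> 1) F"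
    by (rule filterlim_compose)
qed

text \<open>These cut-offs increase to the indicator function of \<open>{a<..<b}\<close> as \<open>n\<close> tends to infinity.\<close>

lemma cutoff_test_function:
  assumes "0 \<le> a" "a \<le> b" "b \<le> L" "0 \<le> n"
  shows "(\<lambda>x. smooth_step (n * ((x - a) * (b - x)) - 1)) \<in> test_functions L"
proof (rule test_functionsI)
  let ?q = "\<lambda>x. n * ((x - a) * (b - x)) - 1"
  let ?D = "\<lambda>x. 2 * max 0 (?q x) / (1 + (max 0 (?q x))\<^sup>2)\<^sup>2 * (n * (a + b - 2 * x))"
  show "((\<lambda>x. smooth_step (?q x)) has_real_derivative ?D x) (at x)" for x
    by (rule DERIV_chain2[OF smooth_step_C1]) (auto intro!: derivative_eq_intros simp: algebra_simps)
  have "(1 + (max 0 (?q x))\<^sup>2)\<^sup>2 \<noteq> 0" for x by (smt (verit) zero_le_power2 power_eq_0_iff)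
  then show "continuous_on UNIV ?D"
    by (intro continuous_intros ballI)
  \<comment> \<open>The shift by 1 in the argument pays off here: the cut-off vanishes where the
    scaled parabola is below 1, so its support avoids \<open>a\<close> and \<open>b\<close> even
    when these are 0 and \<open>L\<close>.\<close>
  show "compact ({a..b} \<inter> {x. 1 \<le> n * ((x - a) * (b - x))})"
    by (intro compact_Int_closed compact_Icc closed_Collect_le continuous_intros)
  show "{a..b} \<inter> {x. 1 \<le> n * ((x - a) * (b - x))} \<subseteq> {0<..<L}"
  proof
    fix x assume x: "x \<in> {a..b} \<inter> {x. 1 \<le> n * ((x - a) * (b - x))}"
    then have "x \<noteq> a" "x \<noteq> b" by auto
    then show "x \<in> {0<..<L}" using x assms by auto
  qed
  fix x assume x: "x \<notin> {a..b} \<inter> {x. 1 \<le> n * ((x - a) * (b - x))}"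
  have "?q x \<le> 0"
  proof (cases "x \<in> {a..b}")
    case False
    then have "(x - a) * (b - x) \<le> 0" using assms(2) by (auto simp: mult_le_0_iff)
    then have "n * ((x - a) * (b - x)) \<le> 0" using assms(4) by (simp add: mult_le_0_iff)
    then show ?thesis by simp
  qed (use x in auto)
  then show "smooth_step (?q x) = 0" by (rule smooth_step_eq_0)
qed

text \<open>The cut-offs are bounded by 1 and converge at every point to the indicator, so dominated
  convergence with majorant \<open>\<bar>g\<bar>\<close> extends the hypothesis from test functions
  to indicators of intervals.\<close>

lemma interval_integral_eq_0_of_test_functions:
  assumes g: "integrable (omega_measure L) g"
    and zero: "\<And>\<phi>. \<phi> \<in> test_functions L \<Longrightarrow> (LINT x|omega_measure L. g x * \<phi> x) = 0"
    and ab: "0 \<le> a" "a \<le> b" "b \<le> L"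
  shows "(LINT x|omega_measure L. indicator {a<..<b} x * g x) = 0"
proof -
  let ?\<phi> = "\<lambda>n::nat. \<lambda>x. smooth_step (real n * ((x - a) * (b - x)) - 1)"
  have t: "?\<phi> n \<in> test_functions L" for n by (rule cutoff_test_function) (use ab in auto)
  have lim: "(\<lambda>n. ?\<phi> n x) \<longlonglongrightarrow> indicator {a<..<b} x" for x
  proof (cases "x \<in> {a<..<b}")
    case True
    then have "0 < (x - a) * (b - x)" by auto
    then have "filterlim (\<lambda>n. - 1 + real n * ((x - a) * (b - x))) at_top sequentially"
      by (intro filterlim_tendsto_add_at_top[OF tendsto_const]
          filterlim_at_top_mult_tendsto_pos[OF tendsto_const] filterlim_real_sequentially)
    then show ?thesis using smooth_step_tendsto True by (simp add: algebra_simps)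
  next
    case False
    then have "(x - a) * (b - x) \<le> 0" using ab by (auto simp: mult_le_0_iff)
    then have "real n * ((x - a) * (b - x)) \<le> 0" for n by (simp add: mult_le_0_iff)
    then have "?\<phi> n x = 0" for n using smooth_step_eq_0 by (smt (verit))
    then show ?thesis using False by simp
  qed
  have gm: "g \<in> borel_measurable (omega_measure L)" using g by simp
  have pm: "?\<phi> n \<in> borel_measurable (omega_measure L)" for n
    using test_functions_Lsq(1)[OF t] by (simp add: Lsq_def)
  have "(\<lambda>n. LINT x|omega_measure L. g x * ?\<phi> n x) \<longlonglongrightarrow> (LINT x|omega_measure L. g x * indicator {a<..<b} x)"
  proof (rule integral_dominated_convergence)
    show "integrable (omega_measure L) (\<lambda>x. \<bar>g x\<bar>)" using g by simp
    show "AE x in omega_measure L. (\<lambda>n. g x * ?\<phi> n x) \<longlonglongrightarrow> g x * indicator {a<..<b} x"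
      by (intro AE_I2 tendsto_mult tendsto_const lim)
    show "AE x in omega_measure L. norm (g x * ?\<phi> n x) \<le> \<bar>g x\<bar>" for n
      using smooth_step_bounds by (intro AE_I2) (simp add: abs_mult mult_left_le)
    show "(\<lambda>x. g x * ?\<phi> n x) \<in> borel_measurable (omega_measure L)" for n
      by (intro borel_measurable_times gm pm)
    show "(\<lambda>x. g x * indicator {a<..<b} x) \<in> borel_measurable (omega_measure L)"
      by (intro borel_measurable_times gm borel_measurable_LIMSEQ_real[OF lim pm])
  qed
  then show ?thesis by (simp add: zero[OF t] LIMSEQ_const_iff mult.commute)
qed

text \<open>The integral of \<open>g\<close> vanishes on open intervals, which are stable under
  intersection and generate the Borel sets. Induction over disjoint unions and complements gives all
  Borel sets, completion all Lebesgue sets, and a function whose integral over every measurable set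
  is 0 vanishes almost everywhere.\<close>

lemma AE_eq_0_of_test_functions:
  assumes g: "integrable (omega_measure L) g"
    and zero: "\<And>\<phi>. \<phi> \<in> test_functions L \<Longrightarrow> (LINT x|omega_measure L. g x * \<phi> x) = 0"
  shows "AE x in omega_measure L. g x = 0"
proof -
  let ?M = "omega_measure L" and ?S = "{0<..<L}"
  define I where "I A = (LINT x:A \<inter> ?S|?M. g x)" for A
  have I_alt: "I A = (LINT x|?M. indicator A x * g x)" for A
    unfolding I_def set_lebesgue_integral_def
    by (rule Bochner_Integration.integral_cong) (auto simp: indicator_def)
  have sint: "set_integrable ?M (A \<inter> ?S) g" if "A \<in> sets lebesgue" for A
    unfolding set_integrable_def
    by (intro integrable_mult_indicator g sets_omega_measure that)
  have I_interval: "I {a<..<b} = 0" for a b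
  proof (cases "max 0 a \<le> min L b")
    case True
    have "I {a<..<b} = I {max 0 a<..<min L b}"
      by (simp add: I_def) (rule arg_cong[where f="\<lambda>A. set_lebesgue_integral ?M A g"], auto)
    also have "\<dots> = 0"
      unfolding I_alt by (rule interval_integral_eq_0_of_test_functions[OF g zero]) (use True in auto)
    finally show ?thesis .
  next
    case False
    then have "{a<..<b} \<inter> ?S = {}" by auto
    then show ?thesis by (simp add: I_def set_lebesgue_integral_def)
  qed
  have I_borel: "I A = 0" if "A \<in> sets borel" for A
  proof -
    have *: "sets (borel :: real measure) = sigma_sets UNIV (range (\<lambda>(a, b). box a b))"
      by (subst borel_eq_box) simp
    let ?G = "range (\<lambda>(a::real, b). box a b)"
    show ?thesis
    proof (rule sigma_sets_induct_disjoint[of ?G UNIV A "\<lambda>A. I A = 0"])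
      show "Int_stable ?G"
      proof (rule Int_stableI)
        fix X Y assume "X \<in> ?G" "Y \<in> ?G"
        then obtain a b c d where "X = box a b" "Y = box c d" by auto
        then have "X \<inter> Y = box (max a c) (min b d)" by auto
        then show "X \<inter> Y \<in> ?G" by auto
      qed
      show "A \<in> sigma_sets UNIV ?G" using that unfolding * .
      show "I {} = 0" by (simp add: I_def set_lebesgue_integral_def)
    next
      fix A assume "A \<in> ?G"
      then show "I A = 0" using I_interval by auto
    next
      fix A assume compl: "A \<in> sigma_sets UNIV ?G" "I A = 0"
      have A: "A \<in> sets lebesgue" using compl(1) unfolding *[symmetric] by simp
      have Ac: "UNIV - A \<in> sets lebesgue" using sets.compl_sets[OF A] by simp
      \<comment> \<open>The two pieces partition \<open>?S\<close>, and the integral over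
        \<open>?S\<close> is itself an instance of the interval case.\<close>
      have "(LINT x:(A \<inter> ?S) \<union> ((UNIV - A) \<inter> ?S)|?M. g x) = I A + I (UNIV - A)"
        unfolding I_def by (rule set_integral_Un) (use sint[OF A] sint[OF Ac] in auto)
      moreover have "(A \<inter> ?S) \<union> ((UNIV - A) \<inter> ?S) = ?S \<inter> ?S" by auto
      ultimately have "I ?S = I A + I (UNIV - A)" by (simp only: I_def)
      then show "I (UNIV - A) = 0" using compl(2) I_interval by simp
    next
      fix A :: "nat \<Rightarrow> real set"
      assume union: "disjoint_family A" "range A \<subseteq> sigma_sets UNIV ?G" "\<And>i. I (A i) = 0"
      have A: "A i \<in> sets lebesgue" for i
        using union(2) unfolding *[symmetric] by (simp add: image_subset_iff)
      have "I (\<Union>i. A i) = (LINT x:(\<Union>i. A i \<inter> ?S)|?M. g x)"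
        by (simp add: I_def)
      also have "\<dots> = (\<Sum>i. I (A i))"
        unfolding I_def
      proof (rule lebesgue_integral_countable_add)
        show "A i \<inter> ?S \<in> sets ?M" for i by (intro sets_omega_measure A)
        show "A i \<inter> ?S \<inter> (A j \<inter> ?S) = {}" if "i \<noteq> j" for i j
          using disjoint_family_onD[OF union(1) _ _ that] by auto
        show "set_integrable ?M (\<Union>i. A i \<inter> ?S) g"
          using sint[of "\<Union>i. A i"] A by auto
      qed
      finally show "I (\<Union>i. A i) = 0" using union(3) by simp
    qed auto
  qed
  interpret finite_measure ?M by (rule omega_measure_finite)
  show ?thesis
  proof (rule density_zero[OF g])
    fix A assume A: "A \<in> sets ?M"
    then have AS: "A \<subseteq> ?S" "A \<in> sets lebesgue" by (auto simp: sets_restrict_space)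
    \<comment> \<open>A Lebesgue set is a Borel set together with part of a null set, so the
      integral over it is that over its Borel part.\<close>
    obtain B N N' where B: "A = B \<union> N" "N \<subseteq> N'" "N' \<in> null_sets lborel" "B \<in> sets lborel"
      using sets_completionE[OF AS(2)] by metis
    have "AE x in lebesgue. x \<notin> N'" 
      using B(3) by (intro AE_not_in null_sets_completionI)
    then have "AE x in lebesgue. x \<in> ?S \<longrightarrow> x \<notin> N'" by eventually_elim simp
    then have "AE x in ?M. x \<notin> N'" by (simp add: AE_restrict_space_iff)
    then have ae: "AE x in ?M. indicator A x *\<^sub>R g x = indicator B x * g x"
      by eventually_elim (use B in \<open>auto simp: indicator_def\<close>)
    have "set_lebesgue_integral ?M A g = I B"
      unfolding I_alt set_lebesgue_integral_def
    proof (rule integral_cong_AE[OF _ _ ae])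
      show "(\<lambda>x. indicator A x *\<^sub>R g x) \<in> borel_measurable ?M"
        using integrable_mult_indicator[OF A g] by simp
      have "B \<inter> ?S \<in> sets ?M" using B(4) by (intro sets_omega_measure) simp
      then have "(\<lambda>x. indicator (B \<inter> ?S) x *\<^sub>R g x) \<in> borel_measurable ?M"
        using integrable_mult_indicator[OF _ g] by blast
      then show "(\<lambda>x. indicator B x * g x) \<in> borel_measurable ?M"
        by (rule measurable_cong[THEN iffD1, rotated]) (auto simp: indicator_def)
    qed
    then show "set_lebesgue_integral ?M A g = 0" using I_borel B(4) by simp
  qed
qed


lemma AE_eq_of_test_functions:
  assumes g: "integrable (omega_measure L) g" "integrable (omega_measure L) h"
    and eq: "\<And>\<phi>. \<phi> \<in> test_functions L \<Longrightarrow>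
      (LINT x|omega_measure L. g x * \<phi> x) = (LINT x|omega_measure L. h x * \<phi> x)"
  shows "AE x in omega_measure L. g x = h x"
proof -
  have "AE x in omega_measure L. g x - h x = 0"
  proof (rule AE_eq_0_of_test_functions)
    show "integrable (omega_measure L) (\<lambda>x. g x - h x)" using g by simp
    fix \<phi> assume t: "\<phi> \<in> test_functions L"
    obtain C where C: "\<And>x. x \<in> {0..L} \<Longrightarrow> \<bar>\<phi> x\<bar> \<le> C"
      using continuous_on_Icc_abs_bounded[OF test_functions_C1(3)[OF t]] by blast
    have "integrable (omega_measure L) (\<lambda>x. u x * \<phi> x)" if u: "integrable (omega_measure L) u" for u
    proof (rule Bochner_Integration.integrable_bound)
      show "integrable (omega_measure L) (\<lambda>x. C * \<bar>u x\<bar>)" using u by simp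
      show "(\<lambda>x. u x * \<phi> x) \<in> borel_measurable (omega_measure L)"
        using u test_functions_Lsq(1)[OF t] by (auto simp: Lsq_def intro!: borel_measurable_times)
      show "AE x in omega_measure L. norm (u x * \<phi> x) \<le> norm (C * \<bar>u x\<bar>)"
      proof (rule AE_omega_measure_I)
        fix x assume "0 < x" "x < L"
        then have "\<bar>\<phi> x\<bar> \<le> \<bar>C\<bar>" using C[of x] by auto
        then have "\<bar>u x\<bar> * \<bar>\<phi> x\<bar> \<le> \<bar>u x\<bar> * \<bar>C\<bar>" by (intro mult_left_mono) auto
        then show "norm (u x * \<phi> x) \<le> norm (C * \<bar>u x\<bar>)" by (simp add: abs_mult mult.commute)
      qed
    qed
    then show "(LINT x|omega_measure L. (g x - h x) * \<phi> x) = 0"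
      using g eq[OF t] by (simp add: left_diff_distrib)
  qed
  then show ?thesis by simp
qed

text \<open>A primitive of \<open>\<eta>\<close> is constant on either side of the support.
  Normalization at 0 makes it vanish on the left, and the zero mean of \<open>\<eta>\<close> carries
  this value to the right.\<close>

lemma test_functions_antiderivative:
  assumes L: "0 < L" and c: "continuous_on UNIV \<eta>"
    and K: "compact K" "K \<subseteq> {0<..<L}" "\<And>x. x \<notin> K \<Longrightarrow> \<eta> x = 0"
    and int: "integral {0..L} \<eta> = 0"
  obtains \<phi> where "\<phi> \<in> test_functions L" "deriv \<phi> = \<eta>"
proof -
  obtain F where F: "\<And>x. (F has_vector_derivative \<eta> x) (at x)"
    using einterval_antiderivative[of "-\<infinity>" "\<infinity>" \<eta>] c by (auto simp: continuous_on_eq_continuous_at)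
  obtain a b where ab: "0 < a" "a < b" "b < L" "K \<subseteq> {a..b}"
    using compact_subset_interval[OF K(1,2) L] .
  define \<phi> where "\<phi> x = F x - F 0" for x
  have d: "(\<phi> has_real_derivative \<eta> x) (at x)" for x
    unfolding \<phi>_def using F[of x]
    by (auto intro!: derivative_eq_intros simp: has_real_derivative_iff_has_vector_derivative[symmetric])
  have "(\<eta> has_integral (F L - F 0)) {0..L}"
    using L F by (intro fundamental_theorem_of_calculus) (auto intro: has_vector_derivative_at_within)
  then have "\<phi> L = 0" using int by (simp add: \<phi>_def integral_unique)
  have "\<phi> 0 = 0" by (simp add: \<phi>_def)
  \<comment> \<open>Applied below to the two outer rays. They contain 0 and \<open>L\<close>, where
    \<open>\<phi>\<close> is known to vanish.\<close>
  have "\<exists>c. \<forall>x\<in>S. \<phi> x = c" if "convex S" "S \<inter> K = {}" for S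
  proof (rule has_field_derivative_zero_constant[OF that(1)])
    fix x assume "x \<in> S"
    then have "\<eta> x = 0" using that(2) K(3) by blast
    then show "(\<phi> has_real_derivative 0) (at x within S)"
        using d[of x] has_field_derivative_at_within by metis
  qed
  moreover have "{..<a} \<inter> K = {}" "{b<..} \<inter> K = {}" using ab by force+
  ultimately have "\<exists>c. \<forall>x\<in>{..<a}. \<phi> x = c" "\<exists>c. \<forall>x\<in>{b<..}. \<phi> x = c"
    using convex_real_interval by blast+
  then have "\<phi> x = 0" if "x \<notin> {a..b}" for x
    using that ab \<open>\<phi> L = 0\<close> \<open>\<phi> 0 = 0\<close>
        by (metis atLeastAtMost_iff greaterThan_iff lessThan_iff not_le_imp_less)
  then have "\<phi> \<in> test_functions L"
    by (intro test_functionsI[OF d c, of "{a..b}"]) (use ab in auto)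
  moreover have "deriv \<phi> = \<eta>" using d by (auto intro!: DERIV_imp_deriv)
  ultimately show ?thesis by (rule that)
qed

text \<open>If all test functions had integral 0, the fundamental lemma applied to the constant 1
  would make an interval of positive length a null set. Some test function thus has nonzero integral
  and can be normalized.\<close>

lemma exists_test_function_integral_1:
  assumes L: "0 < L"
  obtains \<psi> where "\<psi> \<in> test_functions L" "(LINT x|omega_measure L. \<psi> x) = 1"
proof -
  have "\<exists>\<psi>\<in>test_functions L. (LINT x|omega_measure L. 1 * \<psi> x) \<noteq> 0"
  proof (rule ccontr)
    assume "\<not> ?thesis"
    then have "AE x in omega_measure L. (1::real) = 0"
      by (intro AE_eq_0_of_test_functions) (auto intro: Lsq_integrable[OF Lsq_const])
    then have "emeasure (omega_measure L) {0<..<L} = 0"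
      by (subst (asm) AE_iff_measurable[of "{0<..<L}"]) auto
    then show False using L by (simp add: emeasure_restrict_space)
  qed
  then obtain \<psi> where \<psi>: "\<psi> \<in> test_functions L" "(LINT x|omega_measure L. \<psi> x) \<noteq> 0" by auto
  let ?c = "inverse (LINT x|omega_measure L. \<psi> x)"
  obtain K where K: "compact K" "K \<subseteq> {0<..<L}" "\<And>x. x \<notin> K \<Longrightarrow> \<psi> x = 0"
    using \<psi>(1) by (auto simp: test_functions_def)
  show ?thesis
  proof (rule that[of "\<lambda>x. ?c * \<psi> x"])
    show "(\<lambda>x. ?c * \<psi> x) \<in> test_functions L"
      by (rule test_functionsI[OF DERIV_cmult[OF test_functions_C1(1)[OF \<psi>(1)]] _ K(1,2)])
        (auto intro!: continuous_intros test_functions_C1(2)[OF \<psi>(1)] simp: K(3))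
    show "(LINT x|omega_measure L. ?c * \<psi> x) = 1" using \<psi>(2) by simp
  qed
qed

text \<open>This is the lemma of du Bois-Reymond. Each test function is a multiple of a fixed
  \<open>\<psi>0\<close> of integral 1 plus the derivative of a test function, which
  \<open>u\<close> annihilates; hence \<open>u\<close> acts like the constant given by its integral
  against \<open>\<psi>0\<close>.\<close>

lemma weakly_constant_imp_AE_constant:
  assumes L: "0 < L" and u: "u \<in> Lsq L"
    and zero: "\<And>\<phi>. \<phi> \<in> test_functions L \<Longrightarrow> (LINT x|omega_measure L. u x * deriv \<phi> x) = 0"
  obtains c where "AE x in omega_measure L. u x = c"
proof -
  let ?M = "omega_measure L"
  obtain \<psi>0 where \<psi>0: "\<psi>0 \<in> test_functions L" "(LINT x|?M. \<psi>0 x) = 1"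
    using exists_test_function_integral_1[OF L] .
  note i0 = Lsq_integrable[OF test_functions_Lsq(1)[OF \<psi>0(1)]]
  note ui0 = Lsq_mult_integrable[OF u test_functions_Lsq(1)[OF \<psi>0(1)]]
  define c where "c = (LINT x|?M. u x * \<psi>0 x)"
  obtain K0 where K0: "compact K0" "K0 \<subseteq> {0<..<L}" "\<And>x. x \<notin> K0 \<Longrightarrow> \<psi>0 x = 0"
    using \<psi>0(1) by (auto simp: test_functions_def)
  have "AE x in ?M. u x = c"
  proof (rule AE_eq_of_test_functions)
    show "integrable ?M u" "integrable ?M (\<lambda>x. c)" using u by (auto intro!: Lsq_integrable Lsq_const)
    fix \<psi> assume t: "\<psi> \<in> test_functions L"
    obtain K where K: "compact K" "K \<subseteq> {0<..<L}" "\<And>x. x \<notin> K \<Longrightarrow> \<psi> x = 0"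
      using t by (auto simp: test_functions_def)
    note i = Lsq_integrable[OF test_functions_Lsq(1)[OF t]]
    note ui = Lsq_mult_integrable[OF u test_functions_Lsq(1)[OF t]]
    define m where "m = (LINT x|?M. \<psi> x)"
    \<comment> \<open>Subtracting the mean times \<open>\<psi>0\<close> leaves a function with
      integral 0, hence a derivative of a test function.\<close>
    define \<eta> where "\<eta> x = \<psi> x - m * \<psi>0 x" for x
    have "integrable ?M \<eta>" "(LINT x|?M. \<eta> x) = 0"
      using i i0 \<psi>0(2) unfolding \<eta>_def by (auto simp: m_def)
    then have "integral {0..L} \<eta> = 0" by (simp add: integral_omega_measure)
    moreover have "continuous_on UNIV \<eta>"
      unfolding \<eta>_def
          by (intro continuous_intros test_functions_C1(3)[OF t] test_functions_C1(3)[OF \<psi>0(1)])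
    ultimately obtain \<phi> where \<phi>: "\<phi> \<in> test_functions L" "deriv \<phi> = \<eta>"
      using test_functions_antiderivative[OF L, of \<eta> "K \<union> K0"] K K0 by (auto simp: \<eta>_def)
    have "(LINT x|?M. u x * \<eta> x) = (LINT x|?M. u x * \<psi> x) - m * c"
      using ui ui0 unfolding \<eta>_def c_def
      by (simp add: right_diff_distrib mult.left_commute[of _ m])
    then show "(LINT x|?M. u x * \<psi> x) = (LINT x|?M. c * \<psi> x)"
      using zero[OF \<phi>(1)] \<phi>(2) by (simp add: m_def)
  qed
  then show ?thesis by (rule that)
qed

section \<open>The Sobolev space on the interval\<close>

lemma primitive_on_test_function:
  assumes L: "0 < L" and \<phi>: "\<phi> \<in> test_functions L"
  shows "primitive_on L \<phi> (deriv \<phi>)"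
  unfolding primitive_on_def
proof (intro conjI ballI)
  show "deriv \<phi> absolutely_integrable_on {0..L}"
    using test_functions_C1(2)[OF \<phi>] by (rule absolutely_integrable_continuous_real)
  fix x assume "x \<in> {0..L}"
  then have "(deriv \<phi> has_integral (\<phi> x - \<phi> 0)) {0..x}"
    using test_functions_C1(1)[OF \<phi>]
    by (intro fundamental_theorem_of_calculus)
      (auto simp: has_real_derivative_iff_has_vector_derivative intro: has_vector_derivative_at_within)
  then show "\<phi> x = \<phi> 0 + integral {0..x} (deriv \<phi>)" by (simp add: integral_unique)
qed

text \<open>The product rule for \<open>w * \<phi>\<close> is integrated over the whole interval;
  the end-point terms vanish because \<open>\<phi>\<close> is supported inside.\<close>

lemma primitive_on_imp_has_weak_deriv:
  assumes L: "0 < L" and w: "primitive_on L w g" and g: "g \<in> Lsq L"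
  shows "has_weak_deriv L w g"
  unfolding has_weak_deriv_def
proof (intro conjI ballI g)
  show wL: "w \<in> Lsq L" using primitive_on_continuous[OF w] by (rule continuous_on_Lsq)
  fix \<phi> assume t: "\<phi> \<in> test_functions L"
  obtain a b where "0 < a" "a < b" "b < L" "\<And>x. x \<notin> {a..b} \<Longrightarrow> \<phi> x = 0"
    using test_functions_support[OF t L] by metis
  then have b: "\<phi> 0 = 0" "\<phi> L = 0" by auto
  have p: "primitive_on L (\<lambda>x. w x * \<phi> x) (\<lambda>x. w x * deriv \<phi> x + \<phi> x * g x)"
    using L by (intro primitive_on_mult w primitive_on_test_function t) auto
  have i: "integrable (omega_measure L) (\<lambda>x. w x * deriv \<phi> x)" "integrable (omega_measure L) (\<lambda>x. \<phi> x * g x)"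
    by (intro Lsq_mult_integrable wL g test_functions_Lsq t)+
  have "(LINT x|omega_measure L. w x * deriv \<phi> x) + (LINT x|omega_measure L. \<phi> x * g x)
     = (LINT x|omega_measure L. w x * deriv \<phi> x + \<phi> x * g x)"
    using i by simp
  also have "\<dots> = integral {0..L} (\<lambda>x. w x * deriv \<phi> x + \<phi> x * g x)"
    using i by (intro integral_omega_measure) simp
  also have "\<dots> = 0"
    using primitive_on_increment(2)[OF p, of 0 L] L b by simp
  finally show "(LINT x|omega_measure L. w x * deriv \<phi> x) = - (LINT x|omega_measure L. g x * \<phi> x)"
    by (simp add: mult.commute)
qed

lemma has_weak_deriv_cong_AE:
  assumes "has_weak_deriv L u g" "AE x in omega_measure L. u x = v x" "AE x in omega_measure L. g x
      = h x"
  shows "has_weak_deriv L v h"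
proof -
  have m: "u \<in> Lsq L" "v \<in> Lsq L" "g \<in> Lsq L" "h \<in> Lsq L"
    using assms Lsq_cong_AE unfolding has_weak_deriv_def by blast+
  have cong: "(LINT x|omega_measure L. u x * \<phi> x) = (LINT x|omega_measure L. v x * \<phi> x)"
    if "u \<in> Lsq L" "v \<in> Lsq L" "\<phi> \<in> Lsq L" "AE x in omega_measure L. u x = v x" for u v \<phi>
    by (rule integral_cong_AE) (use that Lsq_mult_integrable in auto)
  show ?thesis
    unfolding has_weak_deriv_def
  proof (intro conjI ballI m)
    fix \<phi> assume t: "\<phi> \<in> test_functions L"
    show "(LINT x|omega_measure L. v x * deriv \<phi> x) = - (LINT x|omega_measure L. h x * \<phi> x)"
      using cong[OF m(1,2) test_functions_Lsq(2)[OF t] assms(2)]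
        cong[OF m(3,4) test_functions_Lsq(1)[OF t] assms(3)] assms(1) t
      by (simp add: has_weak_deriv_def)
  qed
qed

text \<open>Forwards, the indefinite integral of \<open>g\<close> is subtracted from
  \<open>u\<close>. The difference has weak derivative 0 and is therefore constant almost
  everywhere; the constant goes into the primitive.\<close>

lemma has_weak_deriv_iff_primitive:
  assumes L: "0 < L"
  shows "has_weak_deriv L u g \<longleftrightarrow>
    g \<in> Lsq L \<and> (\<exists>w. primitive_on L w g \<and> (AE x in omega_measure L. u x = w x))"
proof
  assume h: "has_weak_deriv L u g"
  then have uL: "u \<in> Lsq L" and gL: "g \<in> Lsq L" by (auto simp: has_weak_deriv_def)
  define W where "W x = integral {0..x} g" for x
  have W: "primitive_on L (\<lambda>x. c + W x) g" for c
    using Lsq_integrable[OF gL] by (simp add: primitive_on_def W_def integrable_omega_measure_iff)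
  have hW: "has_weak_deriv L W g"
    using primitive_on_imp_has_weak_deriv[OF L W[of 0] gL] by simp
  then have WL: "W \<in> Lsq L" by (simp add: has_weak_deriv_def)
  obtain c where "AE x in omega_measure L. u x - W x = c"
  proof (rule weakly_constant_imp_AE_constant[OF L Lsq_diff[OF uL WL]])
    fix \<phi> assume t: "\<phi> \<in> test_functions L"
    show "(LINT x|omega_measure L. (u x - W x) * deriv \<phi> x) = 0"
      using h hW t Lsq_mult_integrable[OF uL test_functions_Lsq(2)[OF t]]
        Lsq_mult_integrable[OF WL test_functions_Lsq(2)[OF t]]
      by (simp add: left_diff_distrib has_weak_deriv_def)
  qed
  then have "AE x in omega_measure L. u x = c + W x" by eventually_elim simp
  then show "g \<in> Lsq L \<and> (\<exists>w. primitive_on L w g \<and> (AE x in omega_measure L. u x = w x))"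
    using gL W by blast
next
  assume "g \<in> Lsq L \<and> (\<exists>w. primitive_on L w g \<and> (AE x in omega_measure L. u x = w x))"
  then obtain w where w: "g \<in> Lsq L" "primitive_on L w g" "AE x in omega_measure L. u x = w x" by blast
  have "AE x in omega_measure L. w x = u x" using w(3) by eventually_elim simp
  then show "has_weak_deriv L u g"
    by (intro has_weak_deriv_cong_AE[OF primitive_on_imp_has_weak_deriv[OF L w(2,1)]]) auto
qed

lemma has_weak_deriv_unique_AE:
  assumes "has_weak_deriv L u g" "has_weak_deriv L u h"
  shows "AE x in omega_measure L. g x = h x"
  using assms by (intro AE_eq_of_test_functions) (auto simp: has_weak_deriv_def Lsq_integrable)

lemma H1_has_weak_deriv: "u \<in> H1 L \<Longrightarrow> has_weak_deriv L u (Dx L u)"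
  using someI_ex[of "has_weak_deriv L u"] by (simp add: H1_def Dx_def)

lemma has_weak_deriv_imp_H1: "has_weak_deriv L u g \<Longrightarrow> u \<in> H1 L"
  by (auto simp: H1_def)

lemma Dx_AE_eqI: "has_weak_deriv L u g \<Longrightarrow> AE x in omega_measure L. Dx L u x = g x"
  using H1_has_weak_deriv has_weak_deriv_imp_H1 has_weak_deriv_unique_AE by blast

text \<open>The conclusion is an equality of functions: almost equal arguments satisfy the same weak
  derivative predicate, so the choice operator returns the same derivative.\<close>

lemma Dx_cong_AE:
  assumes "AE x in omega_measure L. u x = v x"
  shows "Dx L u = Dx L v"
proof -
  have "AE x in omega_measure L. v x = u x" using assms by eventually_elim simp
  then have "has_weak_deriv L u g \<longleftrightarrow> has_weak_deriv L v g" for g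
    using has_weak_deriv_cong_AE[of L u g v g] has_weak_deriv_cong_AE[of L v g u g] assms by auto
  then show ?thesis by (simp add: Dx_def)
qed

lemma H1_cong_AE: "u \<in> H1 L \<Longrightarrow> AE x in omega_measure L. u x = v x \<Longrightarrow> v \<in> H1 L"
  using has_weak_deriv_cong_AE[of L u _ v] by (auto simp: H1_def)

lemma H1_Lsq: "u \<in> H1 L \<Longrightarrow> u \<in> Lsq L" and Dx_Lsq: "u \<in> H1 L \<Longrightarrow> Dx L u \<in> Lsq L"
  using H1_has_weak_deriv by (auto simp: has_weak_deriv_def)

text \<open>Inside the interval the functions differ on an open null set, which is empty; the end
  points follow by closure. Traces are well defined for this reason.\<close>

lemma continuous_AE_eq_imp_eq:
  fixes u v :: "real \<Rightarrow> real"
  assumes L: "0 < L" and c: "continuous_on {0..L} u" "continuous_on {0..L} v"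
    and ae: "AE x in omega_measure L. u x = v x" and x: "x \<in> {0..L}"
  shows "u x = v x"
proof -
  have "negligible {x. \<not> (x \<in> {0<..<L} \<longrightarrow> u x = v x)}"
    using ae by (simp add: AE_restrict_space_iff negligible_iff_null_sets completion.AE_iff_null_sets)
  then have neg: "negligible ({0<..<L} \<inter> {x. u x \<noteq> v x})" by (rule negligible_subset) auto
  have "continuous_on {0<..<L} (\<lambda>x. u x - v x)"
    using c by (intro continuous_intros) (auto elim: continuous_on_subset)
  then have "open ({0<..<L} \<inter> (\<lambda>x. u x - v x) -` (- {0}))"
    by (simp add: continuous_on_open_vimage Int_commute open_Compl)
  moreover have "{0<..<L} \<inter> (\<lambda>x. u x - v x) -` (- {0}) = {0<..<L} \<inter> {x. u x \<noteq> v x}" by auto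
  ultimately have "{0<..<L} \<inter> {x. u x \<noteq> v x} = {}" using neg open_not_negligible by metis
  then have "u y - v y = 0" if "y \<in> {0<..<L}" for y using that by auto
  moreover have "closure {0<..<L} = {0..L}" using L by simp
  ultimately have "u x - v x = 0"
    using continuous_constant_on_closure[of "{0<..<L}" "\<lambda>x. u x - v x" 0 x] c x
    by (auto intro!: continuous_intros)
  then show ?thesis by simp
qed

lemma primitive_on_cong:
  assumes "primitive_on L w g" "0 \<le> L" "\<And>x. x \<in> {0..L} \<Longrightarrow> w x = w' x"
  shows "primitive_on L w' g"
  unfolding primitive_on_def
proof (intro conjI ballI primitive_on_integrable[OF assms(1)])
  fix x assume "x \<in> {0..L}"
  then show "w' x = w' 0 + integral {0..x} g"
    using primitive_on_eq[OF assms(1), of x] assms(2) assms(3)[of x] assms(3)[of 0] by simp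
qed

text \<open>\<open>cont_rep\<close> is chosen among all continuous representatives. It coincides on
  the closed interval with the absolutely continuous one, and thereby inherits its being a primitive
  of \<open>Dx L u\<close>.\<close>

lemma cont_rep_H1:
  assumes L: "0 < L" and u: "u \<in> H1 L"
  shows "primitive_on L (cont_rep L u) (Dx L u)" "AE x in omega_measure L. u x = cont_rep L u x"
proof -
  obtain w where w: "primitive_on L w (Dx L u)" "AE x in omega_measure L. u x = w x"
    using H1_has_weak_deriv[OF u] has_weak_deriv_iff_primitive[OF L] by blast
  then have "\<exists>w. continuous_on {0..L} w \<and> (AE x in omega_measure L. u x = w x)"
    using primitive_on_continuous by blast
  then have c: "continuous_on {0..L} (cont_rep L u) \<and> (AE x in omega_measure L. u x = cont_rep L u x)"
    unfolding cont_rep_def by (rule someI_ex)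
  then show "AE x in omega_measure L. u x = cont_rep L u x" by simp
  then have ae: "AE x in omega_measure L. w x = cont_rep L u x" using w(2) by eventually_elim simp
  show "primitive_on L (cont_rep L u) (Dx L u)"
  proof (rule primitive_on_cong[OF w(1)])
    show "w x = cont_rep L u x" if "x \<in> {0..L}" for x
      by (rule continuous_AE_eq_imp_eq[OF L primitive_on_continuous[OF w(1)] _ ae that]) (use c in simp)
  qed (use L in simp)
qed

lemma bdry_value_eqI:
  assumes L: "0 < L" and w: "continuous_on {0..L} w" "AE x in omega_measure L. u x = w x"
    and a: "a \<in> {0..L}"
  shows "bdry_value L u a = w a"
proof -
  have c: "continuous_on {0..L} (cont_rep L u) \<and> (AE x in omega_measure L. u x = cont_rep L u x)"
    unfolding cont_rep_def by (rule someI[of _ w]) (use w in auto)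
  then have "AE x in omega_measure L. u x = cont_rep L u x" by simp
  then have "AE x in omega_measure L. cont_rep L u x = w x" using w(2) by eventually_elim simp
  then show ?thesis
    unfolding bdry_value_def by (rule continuous_AE_eq_imp_eq[OF L _ w(1) _ a, rotated]) (use c in simp)
qed

lemma primitive_on_imp_H1:
  assumes L: "0 < L" and w: "primitive_on L w g" "g \<in> Lsq L"
  shows "w \<in> H1 L" "a \<in> {0..L} \<Longrightarrow> bdry_value L w a = w a"
proof -
  show "w \<in> H1 L"
    by (rule has_weak_deriv_imp_H1[OF primitive_on_imp_has_weak_deriv[OF L w]])
  show "a \<in> {0..L} \<Longrightarrow> bdry_value L w a = w a"
    by (rule bdry_value_eqI[OF L primitive_on_continuous[OF w(1)]]) auto
qed

section \<open>Bounds, algebra operations and traces in H1\<close>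

lemma H1_AE_bounded:
  assumes L: "0 < L" and u: "u \<in> H1 L"
  obtains C where "AE x in omega_measure L. \<bar>u x\<bar> \<le> C"
proof -
  note c = cont_rep_H1[OF L u]
  obtain C where "\<And>x. x \<in> {0..L} \<Longrightarrow> \<bar>cont_rep L u x\<bar> \<le> C"
    using continuous_on_Icc_abs_bounded[OF primitive_on_continuous[OF c(1)]] by blast
  then have "AE x in omega_measure L. \<bar>cont_rep L u x\<bar> \<le> C" by (intro AE_omega_measure_I) auto
  with c(2) have "AE x in omega_measure L. \<bar>u x\<bar> \<le> C" by eventually_elim simp
  then show ?thesis by (rule that)
qed

lemma H1_mult_Lsq:
  assumes L: "0 < L" and u: "u \<in> H1 L" and v: "v \<in> Lsq L"
  shows "(\<lambda>x. u x * v x) \<in> Lsq L" "(\<lambda>x. \<bar>u x\<bar> * v x) \<in> Lsq L"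
proof -
  obtain C where C: "AE x in omega_measure L. \<bar>u x\<bar> \<le> C" using H1_AE_bounded[OF L u] .
  have m: "u \<in> borel_measurable (omega_measure L)" using H1_Lsq[OF u] by (simp add: Lsq_def)
  show "(\<lambda>x. u x * v x) \<in> Lsq L" by (rule Lsq_mult_bounded[OF v m C])
  show "(\<lambda>x. \<bar>u x\<bar> * v x) \<in> Lsq L"
    by (rule Lsq_mult_bounded[OF v, of _ C]) (use m C in auto)
qed

text \<open>The product rule is applied to the continuous representatives; their boundedness keeps
  the derivative in L2, and at an end point the representative of the product is the product of the
  representatives.\<close>

lemma H1_mult:
  assumes L: "0 < L" and u: "u \<in> H1 L" and v: "v \<in> H1 L"
  shows "has_weak_deriv L (\<lambda>x. u x * v x) (\<lambda>x. u x * Dx L v x + v x * Dx L u x)"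
    "(\<lambda>x. u x * v x) \<in> H1 L"
    "a \<in> {0..L} \<Longrightarrow> bdry_value L (\<lambda>x. u x * v x) a = bdry_value L u a * bdry_value L v a"
proof -
  note cu = cont_rep_H1[OF L u] and cv = cont_rep_H1[OF L v]
  let ?U = "cont_rep L u" and ?V = "cont_rep L v"
  let ?w = "\<lambda>x. ?U x * ?V x" and ?g = "\<lambda>x. ?U x * Dx L v x + ?V x * Dx L u x"
  have p: "primitive_on L ?w ?g"
    using L by (intro primitive_on_mult cu cv) auto
  have UV: "?U \<in> H1 L" "?V \<in> H1 L"
    using primitive_on_imp_H1(1)[OF L cu(1) Dx_Lsq[OF u]] primitive_on_imp_H1(1)[OF L cv(1) Dx_Lsq[OF v]] by auto
  have g: "?g \<in> Lsq L"
    by (intro Lsq_add H1_mult_Lsq(1)[OF L] UV Dx_Lsq u v)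
  have ae: "AE x in omega_measure L. ?w x = u x * v x" "AE x in omega_measure L. u x * v x = ?w x"
      "AE x in omega_measure L. ?g x = u x * Dx L v x + v x * Dx L u x"
    using cu(2) cv(2) by (eventually_elim, simp)+
  show h: "has_weak_deriv L (\<lambda>x. u x * v x) (\<lambda>x. u x * Dx L v x + v x * Dx L u x)"
    by (rule has_weak_deriv_cong_AE[OF primitive_on_imp_has_weak_deriv[OF L p g] ae(1,3)])
  then show "(\<lambda>x. u x * v x) \<in> H1 L" by (rule has_weak_deriv_imp_H1)
  show "bdry_value L (\<lambda>x. u x * v x) a = bdry_value L u a * bdry_value L v a" if "a \<in> {0..L}"
    using bdry_value_eqI[OF L primitive_on_continuous[OF p] ae(2) that] by (simp add: bdry_value_def)
qed

lemma H1_linear: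
  assumes L: "0 < L" and u: "u \<in> H1 L" and v: "v \<in> H1 L"
  shows "(\<lambda>x. \<alpha> * u x + \<beta> * v x) \<in> H1 L"
    "a \<in> {0..L} \<Longrightarrow> bdry_value L (\<lambda>x. \<alpha> * u x + \<beta> * v x) a = \<alpha> * bdry_value L u a + \<beta> * bdry_value L v a"
proof -
  have ul: "u \<in> Lsq L" "Dx L u \<in> Lsq L" "v \<in> Lsq L" "Dx L v \<in> Lsq L"
    using u v H1_Lsq Dx_Lsq by auto
  have "has_weak_deriv L (\<lambda>x. \<alpha> * u x + \<beta> * v x) (\<lambda>x. \<alpha> * Dx L u x + \<beta> * Dx L v x)"
    unfolding has_weak_deriv_def
  proof (intro conjI ballI Lsq_add Lsq_cmult ul)
    fix \<phi> assume t: "\<phi> \<in> test_functions L"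
    note i = Lsq_mult_integrable[OF _ test_functions_Lsq(1)[OF t]] Lsq_mult_integrable[OF _ test_functions_Lsq(2)[OF t]]
    show "(LINT x|omega_measure L. (\<alpha> * u x + \<beta> * v x) * deriv \<phi> x)
      = - (LINT x|omega_measure L. (\<alpha> * Dx L u x + \<beta> * Dx L v x) * \<phi> x)"
      using H1_has_weak_deriv[OF u] H1_has_weak_deriv[OF v] t i[OF ul(1)] i[OF ul(2)] i[OF ul(3)] i[OF ul(4)]
      by (simp add: has_weak_deriv_def distrib_right mult.assoc)
  qed
  then show "(\<lambda>x. \<alpha> * u x + \<beta> * v x) \<in> H1 L" by (rule has_weak_deriv_imp_H1)
  note cu = cont_rep_H1[OF L u] and cv = cont_rep_H1[OF L v]
  have "AE x in omega_measure L. \<alpha> * u x + \<beta> * v x = \<alpha> * cont_rep L u x + \<beta> * cont_rep L v x"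
    using cu(2) cv(2) by eventually_elim simp
  then show "bdry_value L (\<lambda>x. \<alpha> * u x + \<beta> * v x) a = \<alpha> * bdry_value L u a + \<beta> * bdry_value L v a"
    if "a \<in> {0..L}"
    by (subst bdry_value_eqI[OF L _ _ that])
      (auto simp: bdry_value_def intro!: continuous_intros primitive_on_continuous[OF cu(1)] primitive_on_continuous[OF cv(1)])
qed

lemma H1_add: "0 < L \<Longrightarrow> u \<in> H1 L \<Longrightarrow> v \<in> H1 L \<Longrightarrow> (\<lambda>x. u x + v x) \<in> H1 L"
  using H1_linear(1)[of L u v 1 1] by simp

lemma primitive_on_affine: "primitive_on L (\<lambda>x. a + b * x) (\<lambda>x. b)"
  by (auto simp: primitive_on_def)

lemma affine_H1:
  assumes "0 < L"
  shows "(\<lambda>x. a + b * x) \<in> H1 L" "y \<in> {0..L} \<Longrightarrow> bdry_value L (\<lambda>x. a + b * x) y = a + b * y"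
  by (rule primitive_on_imp_H1[OF assms primitive_on_affine Lsq_const]; assumption)+

lemma const_H1: "0 < L \<Longrightarrow> (\<lambda>x. a) \<in> H1 L" "0 < L \<Longrightarrow> y \<in> {0..L} \<Longrightarrow> bdry_value L (\<lambda>x. a) y = a"
  using affine_H1(1)[of L a 0] affine_H1(2)[of L y a 0] by simp_all

lemma H1_cmult: "0 < L \<Longrightarrow> u \<in> H1 L \<Longrightarrow> (\<lambda>x. c * u x) \<in> H1 L"
  using H1_mult(2)[OF _ const_H1(1)] by blast

lemma Dx_0: "AE x in omega_measure L. Dx L (\<lambda>x. 0) x = 0"
  by (rule Dx_AE_eqI) (simp add: has_weak_deriv_def Lsq_const)

lemma test_function_H1:
  assumes L: "0 < L" and t: "\<phi> \<in> test_functions L"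
  shows "\<phi> \<in> H1 L" "bdry_value L \<phi> 0 = 0" "bdry_value L \<phi> L = 0"
proof -
  note p = primitive_on_imp_H1[OF L primitive_on_test_function[OF L t] test_functions_Lsq(2)[OF t]]
  obtain a b where "0 < a" "a < b" "b < L" "\<And>x. x \<notin> {a..b} \<Longrightarrow> \<phi> x = 0"
    using test_functions_support[OF t L] by metis
  then show "\<phi> \<in> H1 L" "bdry_value L \<phi> 0 = 0" "bdry_value L \<phi> L = 0" using p L by auto
qed

lemma H1_inverse:
  assumes L: "0 < L" and u: "u \<in> H1 L" and c: "0 < c" "AE x in omega_measure L. c \<le> u x"
  shows "(\<lambda>x. inverse (u x)) \<in> H1 L"
proof -
  note cu = cont_rep_H1[OF L u]
  let ?U = "cont_rep L u"
  have cU: "continuous_on {0..L} ?U" by (rule primitive_on_continuous[OF cu(1)])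
  \<comment> \<open>The lower bound is known only almost everywhere. Written as an equality of two
    continuous functions it extends to all of \<open>[0,L]\<close>, as the inversion lemma
    requires.\<close>
  have "AE x in omega_measure L. max c (?U x) = ?U x"
    using cu(2) c(2) by eventually_elim simp
  then have "max c (?U x) = ?U x" if "x \<in> {0..L}" for x
    by (rule continuous_AE_eq_imp_eq[OF L _ cU _ that, rotated]) (intro continuous_intros cU)
  then have ge: "c \<le> ?U x" if "x \<in> {0..L}" for x using that by (metis max.cobounded1)
  have p: "primitive_on L (\<lambda>x. inverse (?U x)) (\<lambda>x. - (inverse (?U x))\<^sup>2 * Dx L u x)"
    using L by (intro primitive_on_inverse[OF _ cu(1) c(1) ge]) auto
  have "continuous_on {0..L} (\<lambda>x. - (inverse (?U x))\<^sup>2)"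
    using ge c(1) by (intro continuous_intros cU) force
  then obtain C where C: "\<And>x. x \<in> {0..L} \<Longrightarrow> \<bar>- (inverse (?U x))\<^sup>2\<bar> \<le> C"
    and m: "(\<lambda>x. - (inverse (?U x))\<^sup>2) \<in> Lsq L"
    using continuous_on_Icc_abs_bounded continuous_on_Lsq by meson
  have "AE x in omega_measure L. \<bar>- (inverse (?U x))\<^sup>2\<bar> \<le> C"
    by (rule AE_omega_measure_I) (rule C, simp)
  then have "(\<lambda>x. - (inverse (?U x))\<^sup>2 * Dx L u x) \<in> Lsq L"
    using m by (intro Lsq_mult_bounded Dx_Lsq u) (auto simp: Lsq_def)
  then have "(\<lambda>x. inverse (?U x)) \<in> H1 L" by (rule primitive_on_imp_H1(1)[OF L p])
  moreover have "AE x in omega_measure L. inverse (?U x) = inverse (u x)"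
    using cu(2) by eventually_elim simp
  ultimately show ?thesis by (rule H1_cong_AE)
qed

lemma integration_by_parts_H1:
  assumes L: "0 < L" and u: "u \<in> H1 L" and v: "v \<in> H1 L"
  shows "integrable (omega_measure L) (\<lambda>x. u x * Dx L v x + v x * Dx L u x)"
    "(LINT x|omega_measure L. u x * Dx L v x + v x * Dx L u x)
      = bdry_value L u L * bdry_value L v L - bdry_value L u 0 * bdry_value L v 0"
proof -
  note cu = cont_rep_H1[OF L u] and cv = cont_rep_H1[OF L v]
  let ?U = "cont_rep L u" and ?V = "cont_rep L v"
  let ?g = "\<lambda>x. ?U x * Dx L v x + ?V x * Dx L u x"
  have p: "primitive_on L (\<lambda>x. ?U x * ?V x) ?g"
    using L by (intro primitive_on_mult cu cv) auto
  have i: "integrable (omega_measure L) ?g"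
    using primitive_on_integrable[OF p] by (simp add: integrable_omega_measure_iff)
  show i': "integrable (omega_measure L) (\<lambda>x. u x * Dx L v x + v x * Dx L u x)"
    by (intro Bochner_Integration.integrable_add Lsq_mult_integrable H1_Lsq Dx_Lsq u v)
  have "(LINT x|omega_measure L. u x * Dx L v x + v x * Dx L u x) = (LINT x|omega_measure L. ?g x)"
  proof (rule integral_cong_AE)
    show "AE x in omega_measure L. u x * Dx L v x + v x * Dx L u x = ?g x"
      using cu(2) cv(2) by eventually_elim simp
  qed (use i i' in auto)
  also have "\<dots> = integral {0..L} ?g" by (rule integral_omega_measure[OF i])
  also have "\<dots> = ?U L * ?V L - ?U 0 * ?V 0"
    using primitive_on_increment(2)[OF p, of 0 L] L by simp
  finally show "(LINT x|omega_measure L. u x * Dx L v x + v x * Dx L u x)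
      = bdry_value L u L * bdry_value L v L - bdry_value L u 0 * bdry_value L v 0"
    by (simp add: bdry_value_def)
qed

section \<open>The Stokes-Dirac structure\<close>

lemma inner_vec3: "(u :: real^3) \<bullet> v = u $ 1 * v $ 1 + u $ 2 * v $ 2 + u $ 3 * v $ 3"
  by (simp add: inner_vec_def sum_3)

lemma inner_vec2: "(u :: real^2) \<bullet> v = u $ 1 * v $ 1 + u $ 2 * v $ 2"
  by (simp add: inner_vec_def sum_2)

lemma cubed_iff: "u \<in> cubed X \<longleftrightarrow> (\<lambda>x. u x $ 1) \<in> X \<and> (\<lambda>x. u x $ 2) \<in> X \<and> (\<lambda>x. u x $ 3) \<in> X"
  by (simp add: cubed_def forall_3)

lemma cubed_nth: "u \<in> cubed X \<Longrightarrow> (\<lambda>x. u x $ i) \<in> X"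
  by (simp add: cubed_def)

lemma cubed_H1_Lsq: "u \<in> cubed (H1 L) \<Longrightarrow> u \<in> cubed (Lsq L)"
  by (auto simp: cubed_def intro: H1_Lsq)

lemma cubed_Lsq_linear:
  "u \<in> cubed (Lsq L) \<Longrightarrow> v \<in> cubed (Lsq L) \<Longrightarrow> (\<lambda>x. a *\<^sub>R u x + b *\<^sub>R v x) \<in> cubed (Lsq L)"
  by (auto simp: cubed_def intro!: Lsq_add Lsq_cmult)

lemma cubed_H1_linear:
  "0 < L \<Longrightarrow> u \<in> cubed (H1 L) \<Longrightarrow> v \<in> cubed (H1 L) \<Longrightarrow> (\<lambda>x. a *\<^sub>R u x + b *\<^sub>R v x) \<in> cubed (H1 L)"
  by (auto simp: cubed_def intro: H1_linear(1))

lemma cubed_axis: "(\<lambda>x. 0) \<in> X \<Longrightarrow> \<phi> \<in> X \<Longrightarrow> (\<lambda>x. axis i (\<phi> x)) \<in> cubed X"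
proof -
  assume "(\<lambda>x. 0) \<in> X" "\<phi> \<in> X"
  then have "(\<lambda>x. axis i (\<phi> x) $ j) \<in> X" for j by (cases "j = i") (simp_all add: axis_def)
  then show ?thesis by (simp add: cubed_def)
qed

lemma cubed_Lsq_inner_integrable:
  assumes "u \<in> cubed (Lsq L)" "v \<in> cubed (Lsq L)"
  shows "integrable (omega_measure L) (\<lambda>x. u x \<bullet> v x)"
  unfolding inner_vec3
  by (intro Bochner_Integration.integrable_add Lsq_mult_integrable cubed_nth[OF assms(1)] cubed_nth[OF assms(2)])

text \<open>The test fields have zero traces, so that an orthogonality relation can be used here
  after its boundary ports have dropped out.\<close>

lemma cubed_AE_eq_of_test_functions:
  assumes "u \<in> cubed (Lsq L)" "v \<in> cubed (Lsq L)" "0 < L"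
    and eq: "\<And>w. w \<in> cubed (H1 L) \<Longrightarrow> (\<And>i a. a \<in> {0, L} \<Longrightarrow> bdry_value L (\<lambda>x. w x $ i) a = 0) \<Longrightarrow>
      (LINT x|omega_measure L. u x \<bullet> w x) = (LINT x|omega_measure L. v x \<bullet> w x)"
  shows "AE x in omega_measure L. u x = v x"
proof -
  have *: "AE x in omega_measure L. u x $ i = v x $ i" for i
  proof (rule AE_eq_of_test_functions)
    show "integrable (omega_measure L) (\<lambda>x. u x $ i)" "integrable (omega_measure L) (\<lambda>x. v x $ i)"
      using assms by (auto intro: Lsq_integrable cubed_nth)
    fix \<phi> assume t: "\<phi> \<in> test_functions L"
    have "(LINT x|omega_measure L. u x \<bullet> axis i (\<phi> x)) = (LINT x|omega_measure L. v x \<bullet> axis i (\<phi> x))"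
    proof (rule eq)
      show "(\<lambda>x. axis i (\<phi> x)) \<in> cubed (H1 L)"
        by (intro cubed_axis const_H1 test_function_H1 t assms(3))
      show "bdry_value L (\<lambda>x. axis i (\<phi> x) $ j) a = 0" if "a \<in> {0, L}" for j a
        using that test_function_H1(2,3)[OF assms(3) t] const_H1(2)[OF assms(3), of a 0] assms(3)
        by (cases "j = i") (auto simp: axis_def)
    qed
    then show "(LINT x|omega_measure L. u x $ i * \<phi> x) = (LINT x|omega_measure L. v x $ i * \<phi> x)"
      by (simp add: inner_axis)
  qed
  show ?thesis using *[of 1] *[of 2] *[of 3]
    by eventually_elim (simp add: vec_eq_iff forall_3)
qed

lemma power_product_integrable:
  assumes "f \<in> port_space L" "e \<in> port_space L"
  shows "integrable (omega_measure L)
    (\<lambda>x. port_S f x \<bullet> port_S e x + port_R f x \<bullet> port_R e x + port_P f x * port_P e x)"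
  using assms unfolding port_space_def
  by (intro Bochner_Integration.integrable_add cubed_Lsq_inner_integrable Lsq_mult_integrable)
    (auto intro: cubed_H1_Lsq)

section \<open>The operator \<open>J\<close> at a fixed admissible state\<close>

locale gas_state =
  fixes P :: pipe and z :: state
  assumes valid: "valid_pipe P" and admissible: "admissible_state P z"
begin

abbreviation "L \<equiv> len P"
abbreviation "\<rho> \<equiv> density z"
abbreviation "v \<equiv> velocity z"
abbreviation "en \<equiv> energy z"
abbreviation "p \<equiv> pressure P z"
abbreviation "enthalpy x \<equiv> (en x + p x) / \<rho> x"
abbreviation "fr x \<equiv> fric P / (2 * diam P) * v x * \<bar>v x\<bar>"

lemma L_pos: "0 < L"
  using valid by (simp add: valid_pipe_def)

lemma state_H1: "\<rho> \<in> H1 L" "v \<in> H1 L" "en \<in> H1 L" "p \<in> H1 L" "(\<lambda>x. 1 / \<rho> x) \<in> H1 L"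
  "(\<lambda>x. en x / \<rho> x) \<in> H1 L"
proof -
  show H: "\<rho> \<in> H1 L" "v \<in> H1 L" "en \<in> H1 L"
    using admissible unfolding admissible_state_def density_def[abs_def] velocity_def[abs_def] energy_def[abs_def]
    by (auto intro: cubed_nth)
  show "p \<in> H1 L"
    unfolding pressure_def[abs_def] by (intro H1_cmult L_pos H)
  obtain c where "0 < c" "AE x in omega_measure L. c \<le> \<rho> x"
    using admissible by (auto simp: admissible_state_def)
  then show I: "(\<lambda>x. 1 / \<rho> x) \<in> H1 L"
    using H1_inverse[OF L_pos H(1)] by (simp add: inverse_eq_divide)
  show "(\<lambda>x. en x / \<rho> x) \<in> H1 L"
    using H1_mult(2)[OF L_pos H(3) I] by simp
qed

text \<open>The trace is split in the form in which integration by parts produces it: one summand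
  from the \<open>e/\<rho>\<close> entries of \<open>J\<close>, the other from the entries with
  \<open>1/\<rho>\<close> and \<open>p\<close>.\<close>

lemma bdry_value_enthalpy:
  assumes "a \<in> {0..L}"
  shows "bdry_value L enthalpy a =
    bdry_value L (\<lambda>x. en x / \<rho> x) a + bdry_value L (\<lambda>x. 1 / \<rho> x) a * bdry_value L p a"
proof -
  have "enthalpy = (\<lambda>x. 1 * (en x / \<rho> x) + 1 * (1 / \<rho> x * p x))"
    by (auto simp: add_divide_distrib)
  then show ?thesis
    using H1_linear(2)[OF L_pos state_H1(6) H1_mult(2)[OF L_pos state_H1(5,4)] assms, of 1 1]
      H1_mult(3)[OF L_pos state_H1(5,4) assms] by simp
qed

lemma J_op_nth:
  "J_op P z u x $ 1 = - Dx L (\<lambda>y. u y $ 2) x"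
  "J_op P z u x $ 2 = - Dx L (\<lambda>y. u y $ 1) x - fr x * u x $ 3 - en x / \<rho> x * Dx L (\<lambda>y. u y $ 3) x
     - 1 / \<rho> x * Dx L (\<lambda>y. p y * u y $ 3) x"
  "J_op P z u x $ 3 = fr x * u x $ 2 - Dx L (\<lambda>y. en y / \<rho> y * u y $ 2) x
     - p x * Dx L (\<lambda>y. 1 / \<rho> y * u y $ 2) x"
  by (simp_all add: J_op_def gDg_def Let_def)

text \<open>\<open>J\<close> is applied to efforts known only almost everywhere. Its derivatives
  depend on whole functions but do not see null sets, by \<open>Dx_cong_AE\<close>.\<close>

lemma J_op_cong_AE:
  assumes "AE x in omega_measure L. u x = w x"
  shows "AE x in omega_measure L. J_op P z u x = J_op P z w x"
proof -
  have Dx_eq: "Dx L (\<lambda>y. u y $ i) = Dx L (\<lambda>y. w y $ i)"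
    "Dx L (\<lambda>y. g y * u y $ i) = Dx L (\<lambda>y. g y * w y $ i)" for g i
    by (rule Dx_cong_AE, use assms in \<open>eventually_elim, simp\<close>)+
  show ?thesis
    using assms by eventually_elim (simp add: vec_eq_iff forall_3 J_op_nth Dx_eq del: times_divide_eq_left)
qed

text \<open>Almost everywhere only: \<open>Dx\<close> of the zero function is some weak derivative
  and may be nonzero on a null set.\<close>

lemma J_op_zero: "AE x in omega_measure L. J_op P z (\<lambda>x. 0) x = 0"
  using Dx_0[of L] by eventually_elim (simp add: vec_eq_iff forall_3 J_op_nth)

lemma component_H1:
  assumes "u \<in> cubed (H1 L)"
  shows "(\<lambda>x. u x $ i) \<in> H1 L" "(\<lambda>x. p x * u x $ i) \<in> H1 L" "(\<lambda>x. en x / \<rho> x * u x $ i) \<in> H1 L"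
    "(\<lambda>x. 1 / \<rho> x * u x $ i) \<in> H1 L"
  by (intro cubed_nth[OF assms] H1_mult(2)[OF L_pos] state_H1)+

lemma J_op_Lsq:
  assumes u: "u \<in> cubed (H1 L)"
  shows "J_op P z u \<in> cubed (Lsq L)"
proof -
  note H = component_H1[OF u]
  have fr: "(\<lambda>x. fr x * w x) \<in> Lsq L" if "w \<in> Lsq L" for w
  proof -
    have "(\<lambda>x. fric P / (2 * diam P) * (v x * (\<bar>v x\<bar> * w x))) \<in> Lsq L"
      by (intro Lsq_cmult H1_mult_Lsq[OF L_pos] state_H1 that)
    then show ?thesis by (simp add: mult.assoc)
  qed
  show ?thesis
    unfolding cubed_iff J_op_nth
    by (intro conjI Lsq_uminus Lsq_diff fr H1_mult_Lsq(1)[OF L_pos] state_H1 Dx_Lsq H H[THEN H1_Lsq])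
qed

lemma has_bochner_integral_by_parts:
  assumes "u \<in> H1 L" "w \<in> H1 L"
  shows "has_bochner_integral (omega_measure L) (\<lambda>x. u x * Dx L w x + w x * Dx L u x)
    (bdry_value L u L * bdry_value L w L - bdry_value L u 0 * bdry_value L w 0)"
  using integration_by_parts_H1[OF L_pos assms] by (simp add: has_bochner_integral_iff)

text \<open>Up to the sign of the boundary flow at \<open>L\<close>, this is the product of the
  boundary flow generated by \<open>u\<close> and the boundary effort generated by
  \<open>w\<close>.\<close>

definition boundary_form :: "(real \<Rightarrow> real^3) \<Rightarrow> (real \<Rightarrow> real^3) \<Rightarrow> real \<Rightarrow> real" where
  "boundary_form u w a = bdry_value L (\<lambda>x. u x $ 2) a *
     (bdry_value L (\<lambda>x. w x $ 1) a + bdry_value L enthalpy a * bdry_value L (\<lambda>x. w x $ 3) a)"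

text \<open>Friction cancels at each point. The twelve derivative terms form six pairs of the shape
  occurring in integration by parts, and only their end-point contributions survive.\<close>

lemma J_op_skew:
  assumes u: "u \<in> cubed (H1 L)" and w: "w \<in> cubed (H1 L)"
  shows "(LINT x|omega_measure L. J_op P z u x \<bullet> w x + u x \<bullet> J_op P z w x) =
    (boundary_form u w 0 + boundary_form w u 0) - (boundary_form u w L + boundary_form w u L)"
proof -
  note hu = component_H1[OF u] and hw = component_H1[OF w]
  note parts = has_bochner_integral_by_parts
  have eq: "J_op P z u x \<bullet> w x + u x \<bullet> J_op P z w x =
    - ((u x $ 1 * Dx L (\<lambda>y. w y $ 2) x + w x $ 2 * Dx L (\<lambda>y. u y $ 1) x)
     + (w x $ 1 * Dx L (\<lambda>y. u y $ 2) x + u x $ 2 * Dx L (\<lambda>y. w y $ 1) x)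
     + (en x / \<rho> x * u x $ 2 * Dx L (\<lambda>y. w y $ 3) x + w x $ 3 * Dx L (\<lambda>y. en y / \<rho> y * u y $ 2) x)
     + (en x / \<rho> x * w x $ 2 * Dx L (\<lambda>y. u y $ 3) x + u x $ 3 * Dx L (\<lambda>y. en y / \<rho> y * w y $ 2) x)
     + (1 / \<rho> x * u x $ 2 * Dx L (\<lambda>y. p y * w y $ 3) x + p x * w x $ 3 * Dx L (\<lambda>y. 1 / \<rho> y * u y $ 2) x)
     + (1 / \<rho> x * w x $ 2 * Dx L (\<lambda>y. p y * u y $ 3) x
         + p x * u x $ 3 * Dx L (\<lambda>y. 1 / \<rho> y * w y $ 2) x))" for x
    unfolding inner_vec3 J_op_nth by algebra
  \<comment> \<open>One integration by parts for each of the six brackets of \<open>eq\<close>, in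
    the same order.\<close>
  note sum = has_bochner_integral_minus[OF has_bochner_integral_add[OF has_bochner_integral_add[OF
    has_bochner_integral_add[OF has_bochner_integral_add[OF has_bochner_integral_add[OF
      parts[OF hu(1) hw(1)] parts[OF hw(1) hu(1)]]
      parts[OF hu(3) hw(1)]] parts[OF hw(3) hu(1)]] parts[OF hu(4) hw(2)]] parts[OF hw(4) hu(2)]]]
  have b: "bdry_value L (\<lambda>x. p x * y x $ i) a = bdry_value L p a * bdry_value L (\<lambda>x. y x $ i) a"
    "bdry_value L (\<lambda>x. en x / \<rho> x * y x $ i) a
        = bdry_value L (\<lambda>x. en x / \<rho> x) a * bdry_value L (\<lambda>x. y x $ i) a"
    "bdry_value L (\<lambda>x. 1 / \<rho> x * y x $ i) a
        = bdry_value L (\<lambda>x. 1 / \<rho> x) a * bdry_value L (\<lambda>x. y x $ i) a"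
    if "a \<in> {0..L}" "y \<in> cubed (H1 L)" for y i a
    by (rule H1_mult(3)[OF L_pos] state_H1 cubed_nth that)+
  have ends: "0 \<in> {0..L}" "L \<in> {0..L}" using L_pos by auto
  show ?thesis
    unfolding eq sum[THEN has_bochner_integral_integral_eq] boundary_form_def
      b[OF ends(1) u] b[OF ends(1) w] b[OF ends(2) u] b[OF ends(2) w]
      bdry_value_enthalpy[OF ends(1)] bdry_value_enthalpy[OF ends(2)]
    by algebra
qed

section \<open>Parametrization, isotropy and maximality of the structure\<close>

definition dirac_flow :: "(real \<Rightarrow> real^3) \<Rightarrow> (real \<Rightarrow> real^3) \<Rightarrow> port" where
  "dirac_flow \<phi> u = \<lparr> port_S = \<phi>, port_R = u, port_P = (\<lambda>x. B_vec P \<bullet> u x),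
     port_B = vector [- bdry_value L (\<lambda>x. u x $ 2) L, bdry_value L (\<lambda>x. u x $ 2) 0] \<rparr>"

text \<open>The arguments \<open>\<phi>\<close>, \<open>u\<close>, \<open>s\<close> play the roles
  of \<open>f\<^sub>S\<close>, \<open>e\<^sub>S\<close>, \<open>e\<^sub>P\<close>; the first line of
  the block equation is solved for \<open>e\<^sub>R\<close>.\<close>

definition dirac_effort :: "(real \<Rightarrow> real^3) \<Rightarrow> (real \<Rightarrow> real^3) \<Rightarrow> (real \<Rightarrow> real) \<Rightarrow> port" where
  "dirac_effort \<phi> u s = \<lparr> port_S = u, port_R = (\<lambda>x. - (\<phi> x + J_op P z u x
      + s x *\<^sub>R B_vec P)), port_P = s,
     port_B = vector
       [bdry_value L (\<lambda>x. u x $ 1) L + bdry_value L enthalpy L * bdry_value L (\<lambda>x. u x $ 3) L,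
        bdry_value L (\<lambda>x. u x $ 1) 0 + bdry_value L enthalpy 0 * bdry_value L (\<lambda>x. u x $ 3) 0] \<rparr>"

text \<open>The product conditions come from the algebra property of H1
  (\<open>component_H1\<close>), and the boundary equations are those of the
  parametrization.\<close>

lemma dirac_set_iff:
  "(f, e) \<in> dirac_set P z \<longleftrightarrow> f \<in> port_space L \<and> e \<in> port_space L \<and>
    (AE x in omega_measure L. port_S f x + (J_op P z (port_S e) x + port_R e x
        + port_P e x *\<^sub>R B_vec P) = 0 \<and>
           port_R f x - port_S e x = 0 \<and> port_P f x - B_vec P \<bullet> port_S e x = 0) \<and>
    port_B f = port_B (dirac_flow (port_S f) (port_S e)) \<and>
    port_B e = port_B (dirac_effort (port_S f) (port_S e) (port_P e))"
  using component_H1[of "port_S e"]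
  by (auto simp: dirac_set_def Let_def dirac_flow_def dirac_effort_def port_space_def)

lemma inner_B_Lsq:
  assumes "u \<in> cubed (Lsq L)"
  shows "(\<lambda>x. B_vec P \<bullet> u x) \<in> Lsq L"
  using Lsq_cmult[OF cubed_nth[OF assms, of 3]]
      by (simp add: inner_vec3 B_vec_def del: times_divide_eq_left)

lemma dirac_effort_R_Lsq:
  assumes "\<phi> \<in> cubed (H1 L)" "u \<in> cubed (H1 L)" "s \<in> Lsq L"
  shows "(\<lambda>x. - (\<phi> x + J_op P z u x + s x *\<^sub>R B_vec P)) \<in> cubed (Lsq L)"
  using cubed_nth[OF cubed_H1_Lsq[OF assms(1)]] cubed_nth[OF J_op_Lsq[OF assms(2)]] assms(3)
  by (auto simp: cubed_def intro!: Lsq_uminus Lsq_add Lsq_cmult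
      simp: mult.commute[of "s _"] simp del: minus_add_distrib)

lemma dirac_pair_mem:
  assumes "\<phi> \<in> cubed (H1 L)" "u \<in> cubed (H1 L)" "s \<in> Lsq L"
  shows "(dirac_flow \<phi> u, dirac_effort \<phi> u s) \<in> dirac_set P z"
  using assms dirac_effort_R_Lsq[OF assms] inner_B_Lsq[OF cubed_H1_Lsq[OF assms(2)]]
  by (auto simp: dirac_set_iff dirac_flow_def dirac_effort_def port_space_def cubed_H1_Lsq)

text \<open>After substitution of the flows, the identity blocks and the \<open>B\<close> blocks
  cancel between the two power products. What remains is minus the symmetrized \<open>J\<close>,
  which \<open>J_op_skew\<close> turns into boundary terms.\<close>

lemma dirac_set_isotropic:
  assumes a: "a \<in> dirac_set P z" and b: "b \<in> dirac_set P z"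
  shows "bilinear_form L a b = 0"
proof -
  obtain f e f' e' where ab: "a = (f, e)" "b = (f', e')" by (metis surj_pair)
  note a = a[unfolded ab dirac_set_iff] and b = b[unfolded ab dirac_set_iff]
  have S: "port_S e \<in> cubed (H1 L)" "port_S e' \<in> cubed (H1 L)" using a b by (auto simp: port_space_def)
  let ?I = "\<lambda>f e x. port_S f x \<bullet> port_S e x + port_R f x \<bullet> port_R e x + port_P f x * port_P e x"
  have i: "integrable (omega_measure L) (?I f e')" "integrable (omega_measure L) (?I f' e)"
    using a b by (auto intro: power_product_integrable)
  have j: "integrable (omega_measure L) (\<lambda>x. J_op P z (port_S e) x \<bullet> port_S e' x
      + port_S e x \<bullet> J_op P z (port_S e') x)"
    by (intro Bochner_Integration.integrable_add cubed_Lsq_inner_integrable J_op_Lsq cubed_H1_Lsq S)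
  have "(LINT x|omega_measure L. ?I f e' x) + (LINT x|omega_measure L. ?I f' e x)
      = (LINT x|omega_measure L. ?I f e' x + ?I f' e x)"
    using i by simp
  also have "\<dots> = (LINT x|omega_measure L. - (J_op P z (port_S e) x \<bullet> port_S e' x
      + port_S e x \<bullet> J_op P z (port_S e') x))"
  proof (rule integral_cong_AE)
    show "(\<lambda>x. ?I f e' x + ?I f' e x) \<in> borel_measurable (omega_measure L)"
      by (rule borel_measurable_integrable[OF Bochner_Integration.integrable_add[OF i]])
    show "(\<lambda>x. - (J_op P z (port_S e) x \<bullet> port_S e' x
        + port_S e x \<bullet> J_op P z (port_S e') x)) \<in> borel_measurable (omega_measure L)"
      by (rule borel_measurable_integrable[OF Bochner_Integration.integrable_minus[OF j]])
    have "AE x in omega_measure L. (port_S f x + (J_op P z (port_S e) x + port_R e x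
        + port_P e x *\<^sub>R B_vec P) = 0 \<and>
           port_R f x - port_S e x = 0 \<and> port_P f x - B_vec P \<bullet> port_S e x = 0)" using a by blast
    moreover have "AE x in omega_measure L. (port_S f' x + (J_op P z (port_S e') x + port_R e' x
        + port_P e' x *\<^sub>R B_vec P) = 0 \<and>
           port_R f' x - port_S e' x = 0 \<and> port_P f' x - B_vec P \<bullet> port_S e' x = 0)" using b by blast
    ultimately show "AE x in omega_measure L. ?I f e' x + ?I f' e x =
        - (J_op P z (port_S e) x \<bullet> port_S e' x + port_S e x \<bullet> J_op P z (port_S e') x)"
    proof eventually_elim
      case (elim x)
      have eqs: "port_S f x = - (J_op P z (port_S e) x + port_R e x + port_P e x *\<^sub>R B_vec P)"
        "port_S f' x = - (J_op P z (port_S e') x + port_R e' x + port_P e' x *\<^sub>R B_vec P)"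
        "port_R f x = port_S e x" "port_R f' x = port_S e' x"
        "port_P f x = B_vec P \<bullet> port_S e x" "port_P f' x = B_vec P \<bullet> port_S e' x"
        using elim unfolding eq_neg_iff_add_eq_0 right_minus_eq by blast+
      show ?case
        unfolding eqs by (simp add: inner_add_left inner_diff_left inner_commute algebra_simps)
    qed
  qed
  also have "\<dots> = boundary_form (port_S e) (port_S e') L + boundary_form (port_S e') (port_S e) L
      - (boundary_form (port_S e) (port_S e') 0 + boundary_form (port_S e') (port_S e) 0)"
    by (simp only: Bochner_Integration.integral_minus J_op_skew[OF S] minus_diff_eq)
  finally have "bilinear_form L a b = \<dots> + port_B f \<bullet> port_B e' + port_B f' \<bullet> port_B e"
    by (simp add: ab bilinear_form_def power_product_def)
  also have "\<dots> = 0"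
    \<comment> \<open>The minus sign in the boundary flow at \<open>L\<close> matches the opposite
      signs of the two end points in integration by parts.\<close>
    using a b by (simp add: inner_vec2 dirac_flow_def dirac_effort_def boundary_form_def algebra_simps)
  finally show ?thesis .
qed


lemma dirac_set_subset: "dirac_set P z \<subseteq> port_space L \<times> port_space L"
  by (auto simp: dirac_set_iff)

lemma orth_compl_dirac_set_subset: "orth_compl L (dirac_set P z) \<subseteq> dirac_set P z"
proof
  fix b assume b: "b \<in> orth_compl L (dirac_set P z)"
  obtain f e where fe: "b = (f, e)" by (metis surj_pair)
  have ps: "f \<in> port_space L" "e \<in> port_space L"
    and orth: "\<And>a. a \<in> dirac_set P z \<Longrightarrow> bilinear_form L (f, e) a = 0"
    using b by (auto simp: orth_compl_def fe)
  have S: "port_S f \<in> cubed (H1 L)" "port_S e \<in> cubed (H1 L)" "port_P e \<in> Lsq L"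
    using ps by (auto simp: port_space_def)
  define F where "F = dirac_flow (port_S f) (port_S e)"
  define E where "E = dirac_effort (port_S f) (port_S e) (port_P e)"
  have FE: "(F, E) \<in> dirac_set P z" unfolding F_def E_def by (rule dirac_pair_mem[OF S])
  then have FE_ps: "F \<in> port_space L" "E \<in> port_space L" using dirac_set_subset by auto
  define q where "q x = port_R f x - port_R F x" for x
  define s where "s x = port_P f x - port_P F x" for x
  define r where "r x = port_R e x - port_R E x" for x
  define bf where "bf = port_B f - port_B F"
  define be where "be = port_B e - port_B E"
  let ?I = "\<lambda>f e x. port_S f x \<bullet> port_S e x + port_R f x \<bullet> port_R e x + port_P f x * port_P e x"
  \<comment> \<open>The difference of \<open>(f, e)\<close> and \<open>(F, E)\<close> has no
    \<open>port_S\<close> parts, and its effort has no \<open>port_P\<close> part either; only the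
    terms listed remain.\<close>
  have key: "(LINT x|omega_measure L. q x \<bullet> port_R h x + s x * port_P h x + port_R g x \<bullet> r x)
      + (bf \<bullet> port_B h + port_B g \<bullet> be) = 0" if gh: "(g, h) \<in> dirac_set P z" for g h
  proof -
    have gh_ps: "g \<in> port_space L" "h \<in> port_space L" using gh dirac_set_subset by auto
    note i = power_product_integrable[OF ps(1) gh_ps(2)] power_product_integrable[OF gh_ps(1) ps(2)]
      power_product_integrable[OF FE_ps(1) gh_ps(2)] power_product_integrable[OF gh_ps(1) FE_ps(2)]
    have "(LINT x|omega_measure L. q x \<bullet> port_R h x + s x * port_P h x + port_R g x \<bullet> r x)
      = (LINT x|omega_measure L. (?I f h x + ?I g e x) - (?I F h x + ?I g E x))"
      by (rule Bochner_Integration.integral_cong)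
        (auto simp: q_def s_def r_def F_def E_def dirac_flow_def dirac_effort_def inner_diff_left inner_diff_right algebra_simps)
    also have "\<dots> = ((LINT x|omega_measure L. ?I f h x) + (LINT x|omega_measure L. ?I g e x))
        - ((LINT x|omega_measure L. ?I F h x) + (LINT x|omega_measure L. ?I g E x))"
      by (simp only: Bochner_Integration.integral_diff Bochner_Integration.integral_add
          Bochner_Integration.integrable_add i)
    finally show ?thesis
      using orth[OF gh] dirac_set_isotropic[OF FE gh]
      by (simp add: bilinear_form_def power_product_def bf_def be_def inner_diff_left inner_diff_right)
  qed
  have qrs: "q \<in> cubed (Lsq L)" "r \<in> cubed (Lsq L)" "s \<in> Lsq L"
    using ps FE_ps unfolding q_def r_def s_def port_space_def cubed_def by (auto intro!: Lsq_diff)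
  have Z: "(\<lambda>x. 0) \<in> cubed (H1 L)" "(\<lambda>x. 0) \<in> cubed (Lsq L)"
    by (auto simp: cubed_def intro: const_H1 L_pos Lsq_const)
  have b0: "bdry_value L (\<lambda>x. 0) 0 = 0" "bdry_value L (\<lambda>x. 0) L = 0"
    using const_H1(2)[OF L_pos] L_pos by auto
  have vec0: "vector [0, 0] = (0 :: real^2)" by (simp add: vec_eq_iff forall_2)
  have J0: "AE x in omega_measure L. J_op P z (\<lambda>x. 0) x = 0" by (rule J_op_zero)
  note pair_simps = dirac_flow_def dirac_effort_def b0 vec0
  \<comment> \<open>With \<open>e\<^sub>S\<close> and \<open>e\<^sub>P\<close> zero, the only port
    seen by \<open>key\<close> is the resistive effort, which is \<open>- \<phi>\<close> almost
    everywhere for an arbitrary \<open>\<phi>\<close> in H1.\<close>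
  have q0: "AE x in omega_measure L. q x = 0"
  proof (rule cubed_AE_eq_of_test_functions[OF qrs(1) Z(2) L_pos])
    fix \<phi> assume \<phi>: "\<phi> \<in> cubed (H1 L)"
    have "(LINT x|omega_measure L. q x \<bullet> port_R (dirac_effort \<phi> (\<lambda>x. 0) (\<lambda>x. 0)) x) = 0"
      using key[OF dirac_pair_mem[OF \<phi> Z(1) Lsq_const[of 0]]] by (simp add: pair_simps)
    also have "(LINT x|omega_measure L. q x \<bullet> port_R (dirac_effort \<phi> (\<lambda>x. 0) (\<lambda>x. 0)) x)
       = (LINT x|omega_measure L. - (q x \<bullet> \<phi> x))"
    proof (rule integral_cong_AE)
      have "port_R (dirac_effort \<phi> (\<lambda>x. 0) (\<lambda>x. 0)) \<in> cubed (Lsq L)"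
        using dirac_effort_R_Lsq[OF \<phi> Z(1) Lsq_const[of 0]] by (simp add: dirac_effort_def)
      then show "(\<lambda>x. q x \<bullet> port_R (dirac_effort \<phi> (\<lambda>x. 0) (\<lambda>x. 0)) x) \<in> borel_measurable (omega_measure L)"
        by (intro borel_measurable_integrable cubed_Lsq_inner_integrable qrs)
      show "(\<lambda>x. - (q x \<bullet> \<phi> x)) \<in> borel_measurable (omega_measure L)"
        by (intro borel_measurable_integrable Bochner_Integration.integrable_minus
            cubed_Lsq_inner_integrable qrs cubed_H1_Lsq \<phi>)
      show "AE x in omega_measure L. q x \<bullet> port_R (dirac_effort \<phi> (\<lambda>x. 0) (\<lambda>x. 0)) x = - (q x \<bullet> \<phi> x)"
        using J0 by eventually_elim (simp add: dirac_effort_def)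
    qed
    finally show "(LINT x|omega_measure L. q x \<bullet> \<phi> x) = (LINT x|omega_measure L. 0 \<bullet> \<phi> x)" by simp
  qed
  \<comment> \<open>Now only \<open>e\<^sub>P\<close> is nonzero. It also changes the resistive
    effort, but that is paired with \<open>q\<close>, already known to vanish.\<close>
  have s0: "AE x in omega_measure L. s x = 0"
  proof (rule AE_eq_0_of_test_functions)
    show "integrable (omega_measure L) s" by (rule Lsq_integrable[OF qrs(3)])
    fix \<psi> assume t: "\<psi> \<in> test_functions L"
    note tL = test_functions_Lsq(1)[OF t]
    have R: "port_R (dirac_effort (\<lambda>x. 0) (\<lambda>x. 0) \<psi>) \<in> cubed (Lsq L)"
      using dirac_effort_R_Lsq[OF Z(1) Z(1) tL] by (simp add: dirac_effort_def)
    have "(LINT x|omega_measure L. s x * \<psi> x)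
      = (LINT x|omega_measure L. q x \<bullet> port_R (dirac_effort (\<lambda>x. 0) (\<lambda>x. 0) \<psi>) x + s x * \<psi> x)"
    proof (rule integral_cong_AE)
      show "AE x in omega_measure L. s x * \<psi> x = q x \<bullet> port_R (dirac_effort (\<lambda>x. 0) (\<lambda>x. 0) \<psi>) x
          + s x * \<psi> x"
        using q0 by eventually_elim simp
    qed (intro borel_measurable_integrable Bochner_Integration.integrable_add
        cubed_Lsq_inner_integrable Lsq_mult_integrable qrs R tL)+
    also have "\<dots> = 0"
      using key[OF dirac_pair_mem[OF Z(1) Z(1) tL]] by (simp add: pair_simps)
    finally show "(LINT x|omega_measure L. s x * \<psi> x) = 0" .
  qed
  \<comment> \<open>With \<open>q\<close> gone and zero \<open>e\<^sub>P\<close>, varying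
    \<open>e\<^sub>S\<close> alone leaves \<open>r\<close> and the boundary defects. Zero traces
    isolate \<open>r\<close>; nonzero traces then reach the boundary.\<close>
  have key': "(LINT x|omega_measure L. r x \<bullet> u x)
     + (bf \<bullet> port_B (dirac_effort (\<lambda>x. 0) u (\<lambda>x. 0)) + port_B (dirac_flow (\<lambda>x. 0) u) \<bullet> be) = 0"
    if u: "u \<in> cubed (H1 L)" for u
  proof -
    have R: "port_R (dirac_effort (\<lambda>x. 0) u (\<lambda>x. 0)) \<in> cubed (Lsq L)"
      using dirac_effort_R_Lsq[OF Z(1) u Lsq_const[of 0]] by (simp add: dirac_effort_def)
    have "(LINT x|omega_measure L. r x \<bullet> u x)
      = (LINT x|omega_measure L. q x \<bullet> port_R (dirac_effort (\<lambda>x. 0) u (\<lambda>x. 0)) x + s x * 0 + u x \<bullet> r x)"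
    proof (rule integral_cong_AE)
      show "AE x in omega_measure L. r x \<bullet> u x = q x \<bullet> port_R (dirac_effort (\<lambda>x. 0) u (\<lambda>x. 0)) x
          + s x * 0 + u x \<bullet> r x"
        using q0 by eventually_elim (simp add: inner_commute)
    qed (intro borel_measurable_integrable Bochner_Integration.integrable_add
        cubed_Lsq_inner_integrable Lsq_mult_integrable qrs R Lsq_const cubed_H1_Lsq u)+
    then show ?thesis
      using key[OF dirac_pair_mem[OF Z(1) u Lsq_const[of 0]]]
      by (simp add: dirac_flow_def dirac_effort_def)
  qed
  have r0: "AE x in omega_measure L. r x = 0"
  proof (rule cubed_AE_eq_of_test_functions[OF qrs(2) Z(2) L_pos])
    fix u assume u: "u \<in> cubed (H1 L)"
      and "\<And>i a. a \<in> {0, L} \<Longrightarrow> bdry_value L (\<lambda>x. u x $ i) a = 0"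
    then have "bdry_value L (\<lambda>x. u x $ i) 0 = 0" "bdry_value L (\<lambda>x. u x $ i) L = 0" for i by auto
    then show "(LINT x|omega_measure L. r x \<bullet> u x) = (LINT x|omega_measure L. 0 \<bullet> u x)"
      using key'[OF u] by (simp add: dirac_flow_def dirac_effort_def vec0)
  qed
  have bnd: "bf = 0 \<and> be = 0"
  proof -
    \<comment> \<open>Affine interpolation makes the boundary effort equal to \<open>bf\<close> and
      the boundary flow equal to \<open>be\<close>, so the remaining relation is a sum of two
      squared norms. The sign of \<open>be $ 1\<close> undoes that of the flow at \<open>L\<close>;
      the third component is 0 to keep the enthalpy out.\<close>
    define u :: "real \<Rightarrow> real^3" where
      "u x = vector [bf $ 2 + (bf $ 1 - bf $ 2) / L * x, be $ 2 + (- be $ 1 - be $ 2) / L * x, 0]" for x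
    have u: "u \<in> cubed (H1 L)"
      unfolding cubed_iff u_def by (simp add: affine_H1 const_H1 L_pos del: times_divide_eq_left)
    have "bdry_value L (\<lambda>x. u x $ 1) a = bf $ 2 + (bf $ 1 - bf $ 2) / L * a"
      "bdry_value L (\<lambda>x. u x $ 2) a = be $ 2 + (- be $ 1 - be $ 2) / L * a"
      "bdry_value L (\<lambda>x. u x $ 3) a = 0" if "a \<in> {0..L}" for a
      unfolding u_def vector_3 by (intro affine_H1(2) const_H1(2) L_pos that)+
    from this[of 0] this[of L]
    have bu: "bdry_value L (\<lambda>x. u x $ 1) L = bf $ 1" "bdry_value L (\<lambda>x. u x $ 1) 0 = bf $ 2"
      "bdry_value L (\<lambda>x. u x $ 2) L = - be $ 1" "bdry_value L (\<lambda>x. u x $ 2) 0 = be $ 2"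
      "bdry_value L (\<lambda>x. u x $ 3) 0 = 0" "bdry_value L (\<lambda>x. u x $ 3) L = 0"
      using L_pos by auto
    have "port_B (dirac_effort (\<lambda>x. 0) u (\<lambda>x. 0)) = bf" "port_B (dirac_flow (\<lambda>x. 0) u) = be"
      by (simp_all add: dirac_flow_def dirac_effort_def bu vec_eq_iff forall_2)
    moreover have "(LINT x|omega_measure L. r x \<bullet> u x) = 0"
      by (rule integral_eq_zero_AE) (use r0 in \<open>eventually_elim, simp\<close>)
    ultimately have "bf \<bullet> bf + be \<bullet> be = 0" using key'[OF u] by simp
    moreover have "0 \<le> bf \<bullet> bf" "0 \<le> be \<bullet> be" by auto
    ultimately have "bf \<bullet> bf = 0" "be \<bullet> be = 0" by linarith+
    then show ?thesis by simp
  qed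
  have "AE x in omega_measure L. port_S f x + (J_op P z (port_S e) x + port_R e x
      + port_P e x *\<^sub>R B_vec P) = 0 \<and>
           port_R f x - port_S e x = 0 \<and> port_P f x - B_vec P \<bullet> port_S e x = 0"
    using q0 s0 r0
    by eventually_elim (simp add: q_def s_def r_def F_def E_def dirac_flow_def dirac_effort_def)
  then show "b \<in> dirac_set P z"
    using ps bnd unfolding fe dirac_set_iff bf_def be_def F_def E_def by simp
qed

lemma stokes_dirac_dirac_set: "stokes_dirac L (dirac_set P z)"
  unfolding stokes_dirac_def
  using dirac_set_subset orth_compl_dirac_set_subset dirac_set_isotropic
  by (auto simp: orth_compl_def)

lemma power_product_dirac_set:
  assumes "(f, e) \<in> dirac_set P z"
  shows "power_product L f e = 0"
  using dirac_set_isotropic[OF assms assms] by (simp add: bilinear_form_def)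

end

section \<open>Bilinearity of the power product and linearity of the structure\<close>

lemma power_product_commute: "power_product L f e = power_product L e f"
  by (simp add: power_product_def inner_commute mult.commute)

lemma power_product_port_comb:
  assumes "f \<in> port_space L" "g \<in> port_space L" "e \<in> port_space L"
  shows "power_product L (port_comb a f b g) e = a * power_product L f e + b * power_product L g e"
proof -
  let ?I = "\<lambda>f e x. port_S f x \<bullet> port_S e x + port_R f x \<bullet> port_R e x + port_P f x * port_P e x"
  have "(LINT x|omega_measure L. ?I (port_comb a f b g) e x)
      = (LINT x|omega_measure L. a * ?I f e x + b * ?I g e x)"
    by (rule Bochner_Integration.integral_cong) (auto simp: port_comb_def inner_add_left algebra_simps)
  also have "\<dots> = a * (LINT x|omega_measure L. ?I f e x) + b * (LINT x|omega_measure L. ?I g e x)"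
    using power_product_integrable[OF assms(1,3)] power_product_integrable[OF assms(2,3)] by simp
  finally show ?thesis
    by (simp add: power_product_def port_comb_def inner_add_left algebra_simps)
qed

lemma port_space_port_comb:
  "0 < L \<Longrightarrow> f \<in> port_space L \<Longrightarrow> g \<in> port_space L \<Longrightarrow> port_comb a f b g \<in> port_space L"
  by (auto simp: port_space_def port_comb_def intro!: cubed_H1_linear cubed_Lsq_linear Lsq_add Lsq_cmult)

text \<open>Orthogonality to a fixed pair is a linear condition; the inclusion of \<open>D\<close>
  in the port space supplies the integrability with which the integrals are split.\<close>

lemma stokes_dirac_imp_linear_subset:
  assumes L: "0 < L" and D: "stokes_dirac L D" "D \<noteq> {}"
  shows "linear_subset D"
proof -
  have ps: "f \<in> port_space L \<and> e \<in> port_space L" if "(f, e) \<in> D" for f e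
    using D(1) that by (auto simp: stokes_dirac_def)
  have "(port_comb a f b f', port_comb a e b e') \<in> orth_compl L D"
    if m: "(f, e) \<in> D" "(f', e') \<in> D" for a b f e f' e'
    unfolding orth_compl_def
  proof (intro CollectI conjI ballI)
    show "(port_comb a f b f', port_comb a e b e') \<in> port_space L \<times> port_space L"
      using ps[OF m(1)] ps[OF m(2)] port_space_port_comb[OF L] by auto
    fix c assume c: "c \<in> D"
    obtain g h where gh: "c = (g, h)" by (metis surj_pair)
    have "m \<in> D \<Longrightarrow> bilinear_form L m c = 0" for m
      using D(1) c by (auto simp: stokes_dirac_def orth_compl_def)
    from this[OF m(1)] this[OF m(2)]
    have "power_product L f h + power_product L g e = 0" "power_product L f' h
        + power_product L g e' = 0"
      by (auto simp: bilinear_form_def gh)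
    then have "a * (power_product L f h + power_product L g e) + b * (power_product L f' h
        + power_product L g e') = 0"
      by simp
    then show "bilinear_form L (port_comb a f b f', port_comb a e b e') c = 0"
      using ps[OF m(1)] ps[OF m(2)] ps[OF c[unfolded gh]]
      by (simp add: bilinear_form_def gh power_product_port_comb power_product_commute[of L g] algebra_simps)
  qed
  then show ?thesis using D by (auto simp: linear_subset_def stokes_dirac_def)
qed

section \<open>The evolution systems\<close>

text \<open>Real derivatives are unique, so both candidates have the same integral against every H1
  direction, and these directions separate L2 functions.\<close>

lemma has_variational_derivative_unique_AE:
  assumes L: "0 < L" and g: "has_variational_derivative L H z g" and h: "has_variational_derivative L H z h"
  shows "AE x in omega_measure L. g x = h x"
  using g h DERIV_unique unfolding has_variational_derivative_def
  by (intro cubed_AE_eq_of_test_functions[OF _ _ L]) blast+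

context gas_state
begin

lemma effort_nth:
  "effort z x $ 1 = 1 / 2 * (v x * v x)" "effort z x $ 2 = \<rho> x * v x" "effort z x $ 3 = 1"
  by (simp_all add: effort_def power2_eq_square)

lemma effort_H1: "effort z \<in> cubed (H1 L)"
  unfolding cubed_iff effort_nth
  by (intro conjI H1_cmult H1_mult(2)[OF L_pos] state_H1 const_H1 L_pos)

text \<open>Along a line through \<open>z\<close> the Hamiltonian is a cubic polynomial in the step
  \<open>\<epsilon>\<close>; its coefficients are the integrals of \<open>h0\<close> to
  \<open>h3\<close>, finite because H1 is an algebra. The derivative at 0 is the linear
  coefficient.\<close>

lemma has_variational_derivative_effort:
  "has_variational_derivative L (hamiltonian L) z (effort z)"
  unfolding has_variational_derivative_def
proof (intro conjI ballI cubed_H1_Lsq[OF effort_H1])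
  fix w assume w: "w \<in> cubed (H1 L)"
  let ?M = "omega_measure L"
  note H = H1_add[OF L_pos] H1_cmult[OF L_pos] H1_mult(2)[OF L_pos] state_H1 cubed_nth[OF w]
  define h0 where "h0 x = \<rho> x * (1 / 2 * (v x * v x)) + en x" for x
  define h1 where "h1 x = 1 / 2 * (v x * v x) * w x $ 1 + \<rho> x * v x * w x $ 2 + w x $ 3" for x
  define h2 where "h2 x = 1 / 2 * (\<rho> x * (w x $ 2 * w x $ 2)) + w x $ 1 * (v x * w x $ 2)" for x
  define h3 where "h3 x = 1 / 2 * (w x $ 1 * (w x $ 2 * w x $ 2))" for x
  have i: "integrable ?M h0" "integrable ?M h1" "integrable ?M h2" "integrable ?M h3"
    unfolding h0_def[abs_def] h1_def[abs_def] h2_def[abs_def] h3_def[abs_def]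
    by (intro Lsq_integrable H1_Lsq H)+
  have "hamiltonian L (\<lambda>x. z x + \<epsilon> *\<^sub>R w x)
      = (LINT x|?M. h0 x) + \<epsilon> * (LINT x|?M. h1 x) + \<epsilon>\<^sup>2 * (LINT x|?M. h2 x)
          + \<epsilon>^3 * (LINT x|?M. h3 x)" for \<epsilon>
  proof -
    have "hamiltonian L (\<lambda>x. z x + \<epsilon> *\<^sub>R w x) = (LINT x|?M. h0 x + \<epsilon> * h1 x + \<epsilon>\<^sup>2 * h2 x + \<epsilon>^3 * h3 x)"
      unfolding hamiltonian_def
      by (rule Bochner_Integration.integral_cong)
        (auto simp: h0_def h1_def h2_def h3_def density_def velocity_def energy_def
          power2_eq_square power3_eq_cube field_simps)
    then show ?thesis using i by simp
  qed
  moreover have "((\<lambda>\<epsilon>. A + \<epsilon> * B + \<epsilon>\<^sup>2 * C + \<epsilon>^3 * D) has_real_derivative B) (at 0)" for A B C D :: real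
    by (auto intro!: derivative_eq_intros)
  moreover have "(LINT x|?M. effort z x \<bullet> w x) = (LINT x|?M. h1 x)"
    by (simp add: inner_vec3 effort_nth h1_def)
  ultimately show "((\<lambda>\<epsilon>. hamiltonian L (\<lambda>x. z x + \<epsilon> *\<^sub>R w x)) has_real_derivative
      (LINT x|?M. effort z x \<bullet> w x)) (at 0)"
    by simp
qed

text \<open>Forwards, \<open>e\<^sub>S\<close> is the effort function almost everywhere by
  uniqueness, and the other ports are eliminated from the block equation. Backwards, the
  parametrized pair with \<open>f\<^sub>S = - zt\<close> is a witness; it belongs to the flow space
  because \<open>zt\<close> is in H1.\<close>

lemma dirac_equations_iff:
  assumes zt: "zt \<in> cubed (H1 L)"
  shows "(\<exists>f e. (AE x in omega_measure L. port_S f x = - (E_mat z x *v zt x)) \<and>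
      has_variational_derivative L (hamiltonian L) z (port_S e) \<and>
      (AE x in omega_measure L. port_R e x = - (R_mat P z x *v port_R f x)) \<and>
      (AE x in omega_measure L. port_P e x = T_amb P) \<and>
      (f, e) \<in> dirac_set P z \<and> (AE x in omega_measure L. port_P f x = y x))
    \<longleftrightarrow> (AE x in omega_measure L.
      E_mat z x *v zt x = (J_op P z (effort z) x - R_mat P z x *v effort z x) + T_amb P *\<^sub>R B_vec P \<and>
      y x = B_vec P \<bullet> effort z x)" (is "?dirac \<longleftrightarrow> ?ph")
proof
  assume ?dirac
  then obtain f e where S: "AE x in omega_measure L. port_S f x = - (E_mat z x *v zt x)"
    and H: "has_variational_derivative L (hamiltonian L) z (port_S e)"
    and R: "AE x in omega_measure L. port_R e x = - (R_mat P z x *v port_R f x)"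
    and T: "AE x in omega_measure L. port_P e x = T_amb P"
    and D: "(f, e) \<in> dirac_set P z" and Y: "AE x in omega_measure L. port_P f x = y x"
    by blast
  have eff: "AE x in omega_measure L. port_S e x = effort z x"
    by (rule has_variational_derivative_unique_AE[OF L_pos H has_variational_derivative_effort])
  have "AE x in omega_measure L. port_S f x + (J_op P z (port_S e) x + port_R e x
      + port_P e x *\<^sub>R B_vec P) = 0 \<and>
      port_R f x - port_S e x = 0 \<and> port_P f x - B_vec P \<bullet> port_S e x = 0"
    using D by (simp add: dirac_set_iff)
  then show ?ph
    using S R T Y eff J_op_cong_AE[OF eff]
    by eventually_elim (auto simp: algebra_simps)
next
  assume ph: ?ph
  let ?f = "dirac_flow (\<lambda>x. - zt x) (effort z)"
  let ?e = "dirac_effort (\<lambda>x. - zt x) (effort z) (\<lambda>x. T_amb P)"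
  have "(\<lambda>x. - zt x) \<in> cubed (H1 L)"
    using cubed_H1_linear[OF L_pos zt zt, of "-1" 0] by simp
  then have "(?f, ?e) \<in> dirac_set P z"
    by (intro dirac_pair_mem effort_H1 Lsq_const)
  \<comment> \<open>The evolution equation enters here: it says that the resistive effort obtained
    from the block equation obeys the resistive law, with \<open>f\<^sub>R\<close> the effort
    function.\<close>
  moreover have "AE x in omega_measure L. port_R ?e x = - (R_mat P z x *v port_R ?f x)"
    "AE x in omega_measure L. port_P ?f x = y x"
    using ph by (eventually_elim, simp add: dirac_flow_def dirac_effort_def E_mat_def)+
  ultimately show ?dirac
    using has_variational_derivative_effort
    by (intro exI[of _ ?f] exI[of _ ?e]) (auto simp: dirac_flow_def dirac_effort_def E_mat_def)
qed

end

text \<open>For a given trajectory and time derivative, both systems are conditions at each time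
  separately, so ports found time by time are assembled into functions of time by choice.\<close>

lemma dirac_system_iff_port_hamiltonian_system:
  assumes P: "valid_pipe P" and reg: "regular_trajectory P I z z_t"
  shows "(\<exists>f e. dirac_system P I z z_t f e \<and>
      (\<forall>t\<in>I. AE x in omega_measure (len P). port_P (f t) x = y t x))
    \<longleftrightarrow> port_hamiltonian_system P I z z_t y"
proof -
  let ?Q = "\<lambda>t f e. (AE x in omega_measure (len P). port_S f x = - (E_mat (z t) x *v z_t t x)) \<and>
      has_variational_derivative (len P) (hamiltonian (len P)) (z t) (port_S e) \<and>
      (AE x in omega_measure (len P). port_R e x = - (R_mat P (z t) x *v port_R f x)) \<and>
      (AE x in omega_measure (len P). port_P e x = T_amb P) \<and>
      (f, e) \<in> dirac_set P (z t) \<and> (AE x in omega_measure (len P). port_P f x = y t x)"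
  have "(\<exists>f e. dirac_system P I z z_t f e \<and> (\<forall>t\<in>I. AE x in omega_measure (len P). port_P (f t) x
      = y t x))
      \<longleftrightarrow> (\<exists>f e. \<forall>t\<in>I. ?Q t (f t) (e t))"
    unfolding dirac_system_def by blast
  also have "\<dots> \<longleftrightarrow> (\<forall>t\<in>I. \<exists>f e. ?Q t f e)"
    by (simp only: bchoice_iff)
  also have "\<dots> \<longleftrightarrow> port_hamiltonian_system P I z z_t y"
    unfolding port_hamiltonian_system_def
  proof (rule ball_cong[OF refl])
    fix t assume "t \<in> I"
    then have "gas_state P (z t)" "z_t t \<in> cubed (H1 (len P))"
      using P reg by (auto simp: regular_trajectory_def gas_state_def)
    then show "(\<exists>f e. ?Q t f e) \<longleftrightarrow> (AE x in omega_measure (len P).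
      E_mat (z t) x *v z_t t x =
        (J_op P (z t) (effort (z t)) x - R_mat P (z t) x *v effort (z t) x) + T_amb P *\<^sub>R B_vec P \<and>
      y t x = B_vec P \<bullet> effort (z t) x)"
      by (rule gas_state.dirac_equations_iff)
  qed
  finally show ?thesis .
qed

theorem theorem7:
  fixes P :: pipe
  assumes "valid_pipe P"
  shows "(\<forall>z. admissible_state P z \<longrightarrow>
            linear_subset (dirac_set P z) \<and>
            stokes_dirac (len P) (dirac_set P z) \<and>
            (\<forall>(f, e)\<in>dirac_set P z. power_product (len P) f e = 0))
       \<and> (\<forall>I z z_t y. is_interval I \<longrightarrow> interior I \<noteq> {} \<longrightarrow> regular_trajectory P I z z_t \<longrightarrow>
            ((\<exists>f e. dirac_system P I z z_t f e \<and>
                (\<forall>t\<in>I. AE x in omega_measure (len P). port_P (f t) x = y t x))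
             \<longleftrightarrow> port_hamiltonian_system P I z z_t y))"
proof (intro conjI allI impI)
  fix z assume "admissible_state P z"
  then interpret gas_state P z using assms by unfold_locales
  show "stokes_dirac (len P) (dirac_set P z)" by (rule stokes_dirac_dirac_set)
  have "(\<lambda>x. 0) \<in> cubed (H1 (len P))" by (simp add: cubed_def const_H1 L_pos)
  then have "dirac_set P z \<noteq> {}" using dirac_pair_mem[OF _ _ Lsq_const] by blast
  with stokes_dirac_dirac_set show "linear_subset (dirac_set P z)"
    by (rule stokes_dirac_imp_linear_subset[OF L_pos])
  show "\<forall>(f, e)\<in>dirac_set P z. power_product (len P) f e = 0"
    using power_product_dirac_set by auto
qed (rule dirac_system_iff_port_hamiltonian_system[OF assms])

end
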